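(* For each $n\ge 3$ let $\bm\mu=\bm\mu^{(n)}=(\mu_1,\dots,\mu_n)$ be a vector of positive reals (the entries may depend on $n$), and let $T_n$ be the number of triangles in the $\beta$-model on $n$ vertices with parameter vector $\bm\mu$, i.e. with independent edges of probabilities $p_{ij}=\mu_i\mu_j/(1+\mu_i\mu_j)$. Let $F_n=(T_n-\mathbb{E}[T_n])/\sqrt{\mathrm{Var}[T_n]}$ and let $\mathcal N$ be a standard normal random variable. Suppose that, as $n\to\infty$, $\mu_{\max}\to 0$ and $\|\bm\mu\|_2\to\infty$. Then there is a constant $C>0$, not depending on $n$, such that for all $n\ge 3$ $$d_K(F_n,\mathcal N)\le \frac{C}{\|\bm\mu\|_2^{5/2}\big(\|\bm\mu\|_3^6+\|\bm\mu\|_2^2\big)}\sum_{\ell=1}^5 A_\ell ,$$ where $$A_1=\|\bm\mu\|_{3/2}^{3/4}\,\|\bm\mu\|_{5/2}^{5/4},\qquad A_2=\|\bm\mu\|_{3/2}^{3/4}\,\|\bm\mu\|_2^{1/2}\,\|\bm\mu\|_{7/2}^{7/4}\,\|\bm\mu\|_4^{2},$$ $$A_3=\|\bm\mu\|_2^{5/2}\,\|\bm\mu\|_5^{5},\qquad A_4=\|\bm\mu\|_2^{3/2}\,\|\bm\mu\|_{5/2}^{5/2}\,\|\bm\mu\|_5^{5/2},\qquad A_5=\|\bm\mu\|_{7/4}^{7/4}\,\|\bm\mu\|_{7/2}^{7/4}.$$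
   Context: The $\beta$-model on vertex set $[n]=\{1,\dots,n\}$ with parameters $\beta_1,\dots,\beta_n\in\mathbb{R}$ (possibly depending on $n$) is the random simple undirected graph in which, for each pair $i\ne j$, the edge $\{i,j\}$ is present with probability $p_{ij}=e^{\beta_i+\beta_j}/(1+e^{\beta_i+\beta_j})$, independently over unordered pairs. Writing $\mu_i=e^{\beta_i}>0$, we have $p_{ij}=\mu_i\mu_j/(1+\mu_i\mu_j)$. Let $I_{ij}=I_{ji}$ be the indicator that the edge $\{i,j\}$ is present. The number of triangles is $T_n=\sum_{1\le i<j<k\le n}I_{ij}I_{jk}I_{ki}$. For a vector $\bm x\in\mathbb{R}^n$ and $s>0$, $\|\bm x\|_s=(\sum_{i=1}^n|x_i|^s)^{1/s}$, and $x_{\max}$ is the maximal entry of $\bm x$. The Kolmogorov distance between random variables $X,Y$ is $d_K(X,Y)=\sup_{z\in\mathbb{R}}|\mathbb{P}(X\le z)-\mathbb{P}(Y\le z)|$. *)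

theory Defs
  imports "HOL-Probability.Probability"
begin

definition lp_norm :: "nat \<Rightarrow> real \<Rightarrow> (nat \<Rightarrow> real) \<Rightarrow> real" where
  "lp_norm n s x = (\<Sum>i=1..n. \<bar>x i\<bar> powr s) powr (1 / s)"

definition vec_max :: "nat \<Rightarrow> (nat \<Rightarrow> real) \<Rightarrow> real" where
  "vec_max n x = Max (x ` {1..n})"

(* In terms of the beta-parameters, m i = exp (beta i) > 0. *)
definition edge_prob :: "(nat \<Rightarrow> real) \<Rightarrow> nat \<Rightarrow> nat \<Rightarrow> real" where
  "edge_prob m i j = m i * m j / (1 + m i * m j)"

(* A graph on {1..n} is encoded by its edge configuration: the unordered pair {i, j} is
   represented by the ordered pair (i, j) with i < j, and all other coordinates are False. *)
definition vertex_pairs :: "nat \<Rightarrow> (nat \<times> nat) set" where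
  "vertex_pairs n = {(i, j). 1 \<le> i \<and> i < j \<and> j \<le> n}"

definition beta_model :: "nat \<Rightarrow> (nat \<Rightarrow> real) \<Rightarrow> (nat \<times> nat \<Rightarrow> bool) pmf" where
  "beta_model n m = Pi_pmf (vertex_pairs n) False (\<lambda>(i, j). bernoulli_pmf (edge_prob m i j))"

definition edge_ind :: "nat \<Rightarrow> nat \<Rightarrow> (nat \<times> nat \<Rightarrow> bool) \<Rightarrow> real" where
  "edge_ind i j g = of_bool (g (min i j, max i j))"

definition triangles :: "nat \<Rightarrow> (nat \<times> nat \<Rightarrow> bool) \<Rightarrow> real" where
  "triangles n g =
     (\<Sum>(i, j, k) \<in> {(i, j, k). 1 \<le> i \<and> i < j \<and> j < k \<and> k \<le> n}.
        edge_ind i j g * edge_ind j k g * edge_ind k i g)"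

definition std_triangles :: "nat \<Rightarrow> (nat \<Rightarrow> real) \<Rightarrow> (nat \<times> nat \<Rightarrow> bool) \<Rightarrow> real" where
  "std_triangles n m g =
     (triangles n g - measure_pmf.expectation (beta_model n m) (triangles n))
       / sqrt (measure_pmf.variance (beta_model n m) (triangles n))"

(* Distance between real random variables X on M and Y on N, which may live on different
   probability spaces. *)
definition kolmogorov_dist ::
  "'a measure \<Rightarrow> ('a \<Rightarrow> real) \<Rightarrow> 'b measure \<Rightarrow> ('b \<Rightarrow> real) \<Rightarrow> real" where
  "kolmogorov_dist M X N Y =
     (SUP z. \<bar>measure M {x \<in> space M. X x \<le> z} - measure N {y \<in> space N. Y y \<le> z}\<bar>)"

end

theory Submission
  imports Defs "HOL-Real_Asymp.Real_Asymp"
begin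

text \<open>
  Let \<open>X\<^sub>e\<close> be the edge indicators, \<open>D\<^sub>e\<close> the difference between presence and absence
  of the edge \<open>e\<close>, \<open>N\<^sub>e = D\<^sub>e T\<close> the number of common neighbours of the end points of \<open>e\<close>. One can
  write \<open>T - E T = (\<Sum>e. (X\<^sub>e - p\<^sub>e) g\<^sub>e)\<close> with \<open>g\<^sub>e \<ge> 0\<close> not depending on \<open>X\<^sub>e\<close>, so that
  \<open>E (T - E T) f(T) = (\<Sum>e. p\<^sub>e (1 - p\<^sub>e) E g\<^sub>e D\<^sub>e f(T))\<close>. For the solution \<open>f\<close> of Stein's
  equation at \<open>z\<close>, the function \<open>w f(w) - 1(w \<le> z)\<close> is increasing and bounded by 2. As \<open>T\<close> is
  increasing in each \<open>X\<^sub>e\<close>, the error of the linearisation of \<open>D\<^sub>e f(T)\<close> is dominated by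
  the \<open>D\<^sub>e\<close> of this function, and undoing the integration by parts turns the sum of the errors into
  the expectation of a bounded variable times \<open>(\<Sum>e. (X\<^sub>e - p\<^sub>e) g\<^sub>e N\<^sub>e)\<close>. Hence, with
  \<open>v = Var T = (\<Sum>e. p\<^sub>e (1 - p\<^sub>e) E g\<^sub>e N\<^sub>e)\<close>, the Kolmogorov distance is at most
  \<open>E\<bar>v - (\<Sum>e. p\<^sub>e (1 - p\<^sub>e) g\<^sub>e N\<^sub>e)\<bar> / v + 2 E\<bar>\<Sum>e. (X\<^sub>e - p\<^sub>e) g\<^sub>e N\<^sub>e\<bar> / v\<close>.

  Write \<open>M\<^sub>s\<close> for the sum of the \<open>\<mu>\<^sub>i^s\<close>. By the Poincare inequality and its analogue for divergences,
  both second moments are \<open>O(M\<^sub>2^3 + M\<^sub>2^4 M\<^sub>5^2)\<close>, while \<open>v\<close> is at least of order \<open>M\<^sub>2^2 (M\<^sub>2 + M\<^sub>3^2)\<close>.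
  As \<open>M\<^sub>2 \<le> A\<^sub>1\<close> by Cauchy-Schwarz and \<open>A\<^sub>3 = M\<^sub>2^(5/4) M\<^sub>5\<close>, the terms \<open>A\<^sub>1\<close> and \<open>A\<^sub>3\<close> already suffice for
  large \<open>n\<close>; the finitely many other \<open>n\<close> are absorbed into the constant.
\<close>

section \<open>Stein's equation for the standard normal law\<close>

definition normal_cdf :: "real \<Rightarrow> real" where
  "normal_cdf z = measure std_normal_distribution {y. y \<le> z}"

lemma normal_cdf_eq_cdf: "normal_cdf = cdf std_normal_distribution"
  by (rule ext) (simp add: normal_cdf_def cdf_def atMost_def)

interpretation std_normal: real_distribution std_normal_distribution
  by (rule real_dist_normal_dist)

lemma normal_cdf_nonneg: "0 \<le> normal_cdf z" and normal_cdf_le_1: "normal_cdf z \<le> 1"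
  by (auto simp: normal_cdf_def)

lemma normal_cdf_diff_eq_integral:
  assumes "a \<le> b"
  shows "normal_cdf b - normal_cdf a = integral {a..b} std_normal_density"
proof (cases "a = b")
  case False
  have int: "set_integrable lborel {a<..b} std_normal_density"
    unfolding set_integrable_def
    by (intro integrable_mult_indicator) (auto simp: integrable_normal_density)
  have "normal_cdf b - normal_cdf a = measure std_normal_distribution {a<..b}"
    using assms False by (simp add: normal_cdf_eq_cdf std_normal.cdf_diff_eq)
  also have "\<dots> = (LINT x|std_normal_distribution. indicator {a<..b} x)"
    by simp
  also have "\<dots> = (LINT x|lborel. std_normal_density x *\<^sub>R indicator {a<..b} x)"
    by (subst integral_density) (auto simp: normal_density_nonneg)
  also have "\<dots> = (LINT x:{a<..b}|lborel. std_normal_density x)"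
    by (auto simp: set_lebesgue_integral_def mult.commute)
  also have "\<dots> = integral {a<..b} std_normal_density"
    by (rule set_borel_integral_eq_integral(2)[OF int])
  also have "\<dots> = integral {a..b} std_normal_density"
    by (rule integral_subset_negligible) (auto intro: negligible_subset[of "{a}"])
  finally show ?thesis .
qed simp

lemma normal_cdf_deriv: "(normal_cdf has_real_derivative std_normal_density x) (at x)"
proof -
  \<comment> \<open>The base point \<open>x-1\<close> is chosen so that \<open>x\<close> is interior
    to the window: the derivative within the window is then the full derivative.\<close>
  have cont: "continuous_on {x-1..x+1} std_normal_density"
    unfolding normal_density_def by (intro continuous_intros) auto
  have "((\<lambda>y. integral {x-1..y} std_normal_density) has_real_derivative std_normal_density x)
      (at x within {x-1..x+1})"
    by (rule integral_has_real_derivative[OF cont]) auto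
  then have "((\<lambda>y. integral {x-1..y} std_normal_density + normal_cdf (x-1))
      has_real_derivative std_normal_density x) (at x within {x-1..x+1})"
    by (auto intro!: derivative_eq_intros)
  then have "(normal_cdf has_real_derivative std_normal_density x) (at x within {x-1..x+1})"
  proof (rule has_field_derivative_transform_within[where d=1])
    fix y assume "y \<in> {x-1..x+1}"
    then show "integral {x-1..y} std_normal_density + normal_cdf (x-1) = normal_cdf y"
      using normal_cdf_diff_eq_integral[of "x-1" y] by simp
  qed auto
  moreover have "at x within {x-1..x+1} = at x"
    by (rule at_within_interior) (auto simp: interior_atLeastAtMost_real)
  ultimately show ?thesis by simp
qed

lemmas normal_cdf_deriv' [derivative_intros] = DERIV_chain2[OF normal_cdf_deriv]

lemma std_normal_density_deriv:
  "(std_normal_density has_real_derivative - x * std_normal_density x) (at x)"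
proof -
  have "((\<lambda>x. 1 / sqrt (2 * pi) * exp (- x\<^sup>2 / 2)) has_real_derivative
      - x * (1 / sqrt (2 * pi) * exp (- x\<^sup>2 / 2))) (at x)"
    by (rule derivative_eq_intros refl | simp)+
  then show ?thesis by (simp only: std_normal_density_def[abs_def])
qed

lemmas std_normal_density_deriv' [derivative_intros] = DERIV_chain2[OF std_normal_density_deriv]

text \<open>A nondecreasing function that tends to 0 at minus infinity cannot be negative. All the
  normal tail estimates below are derived this way, by differentiating instead of estimating
  integrals.\<close>

lemma nonneg_if_deriv_nonneg_at_bot:
  fixes g g' :: "real \<Rightarrow> real"
  assumes deriv: "\<And>x. x \<le> a \<Longrightarrow> (g has_real_derivative g' x) (at x)"
    and nonneg: "\<And>x. x \<le> a \<Longrightarrow> 0 \<le> g' x"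
    and lim: "(g \<longlongrightarrow> 0) at_bot"
  shows "0 \<le> g a"
proof -
  have "g y \<le> g a" if "y \<le> a" for y
    using that by (intro DERIV_nonneg_imp_nondecreasing[OF that]) (use deriv nonneg in auto)
  then have "eventually (\<lambda>y. g y \<le> g a) at_bot"
    by (auto simp: eventually_at_bot_linorder)
  then show ?thesis
    by (intro tendsto_upperbound[OF lim]) auto
qed

section \<open>Decay of the normal tail\<close>

lemma normal_cdf_at_bot: "(normal_cdf \<longlongrightarrow> 0) at_bot"
  unfolding normal_cdf_eq_cdf by (rule std_normal.cdf_lim_at_bot)

lemma std_normal_density_at_bot: "((\<lambda>x. x ^ k * std_normal_density x) \<longlongrightarrow> 0) at_bot"
proof -
  have "((\<lambda>x::real. x ^ k * (1 / sqrt (2 * pi) * exp (- x\<^sup>2 / 2))) \<longlongrightarrow> 0) at_bot"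
    by real_asymp
  then show ?thesis by (simp only: std_normal_density_def)
qed

text \<open>The difference has derivative \<open>(- y - 1) * std_normal_density y\<close>, which is
  nonnegative up to -1. This crude bound serves to show that the tail beats every power.\<close>

lemma normal_cdf_le_density:
  assumes "x \<le> -1"
  shows "normal_cdf x \<le> std_normal_density x"
proof -
  have "0 \<le> std_normal_density x - normal_cdf x"
  proof (rule nonneg_if_deriv_nonneg_at_bot[of x "\<lambda>x. std_normal_density x - normal_cdf x"
        "\<lambda>y. (- y - 1) * std_normal_density y"])
    show "((\<lambda>x. std_normal_density x - normal_cdf x) has_real_derivative
        (- y - 1) * std_normal_density y) (at y)" for y
      by (auto intro!: derivative_eq_intros simp: algebra_simps)
    show "0 \<le> (- y - 1) * std_normal_density y" if "y \<le> x" for y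
      using that assms by (intro mult_nonneg_nonneg) (auto simp: normal_density_nonneg)
    show "((\<lambda>x. std_normal_density x - normal_cdf x) \<longlongrightarrow> 0) at_bot"
      using tendsto_diff[OF std_normal_density_at_bot[of 0] normal_cdf_at_bot] by simp
  qed
  then show ?thesis by simp
qed

lemma power_normal_cdf_at_bot: "((\<lambda>x. x ^ k * normal_cdf x) \<longlongrightarrow> 0) at_bot"
proof (rule Lim_null_comparison[OF _ tendsto_rabs_zero[OF std_normal_density_at_bot[of k]]])
  show "\<forall>\<^sub>F x in at_bot. norm (x ^ k * normal_cdf x) \<le> \<bar>x ^ k * std_normal_density x\<bar>"
    unfolding eventually_at_bot_linorder
    by (rule exI[of _ "-1"])
       (auto simp: abs_mult normal_cdf_nonneg normal_density_nonneg normal_cdf_le_density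
             intro!: mult_left_mono)
qed

section \<open>The reflected Mills ratio\<close>

definition mills :: "real \<Rightarrow> real" where
  "mills w = normal_cdf w / std_normal_density w"

text \<open>The ratio solves \<open>h' - w h = 1\<close>, so its multiples solve Stein's equation on
  either side of the kink.\<close>

lemma mills_deriv: "(mills has_real_derivative 1 + w * mills w) (at w)"
proof -
  have "std_normal_density w > 0" by (simp add: normal_density_pos)
  then show ?thesis unfolding mills_def
    by (auto intro!: derivative_eq_intros simp: field_simps power2_eq_square)
qed

lemmas mills_deriv' [derivative_intros] = DERIV_chain2[OF mills_deriv]

text \<open>As the density has derivative \<open>- w * std_normal_density w\<close>, two terms
  cancel and the derivative of the left side is just \<open>normal_cdf\<close>.\<close>

lemma density_plus_cdf_nonneg: "0 \<le> std_normal_density w + w * normal_cdf w"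
proof (rule nonneg_if_deriv_nonneg_at_bot[of w "\<lambda>w. std_normal_density w + w * normal_cdf w"
      normal_cdf])
  show "((\<lambda>w. std_normal_density w + w * normal_cdf w) has_real_derivative normal_cdf y) (at y)" for y
    by (auto intro!: derivative_eq_intros)
  show "((\<lambda>w. std_normal_density w + w * normal_cdf w) \<longlongrightarrow> 0) at_bot"
    using tendsto_add[OF std_normal_density_at_bot[of 0] power_normal_cdf_at_bot[of 1]] by simp
qed (simp add: normal_cdf_nonneg)

lemma mills_lower: "- 1 \<le> w * mills w"
proof -
  have "std_normal_density w > 0" by (simp add: normal_density_pos)
  then show ?thesis using density_plus_cdf_nonneg[of w]
    by (simp add: mills_def field_simps)
qed

text \<open>After multiplication by the density, the derivative is twice the quantity of
  \<open>density_plus_cdf_nonneg\<close>. The expression itself is the derivative of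
  \<open>w * mills w\<close>, so this is the monotonicity of that product in disguise.\<close>

lemma mills_upper: "0 \<le> (1 + w\<^sup>2) * mills w + w"
proof -
  have "0 \<le> (1 + w\<^sup>2) * normal_cdf w + w * std_normal_density w"
  proof (rule nonneg_if_deriv_nonneg_at_bot[of w
        "\<lambda>w. (1 + w\<^sup>2) * normal_cdf w + w * std_normal_density w"
        "\<lambda>y. 2 * (std_normal_density y + y * normal_cdf y)"])
    show "((\<lambda>w. (1 + w\<^sup>2) * normal_cdf w + w * std_normal_density w) has_real_derivative
        2 * (std_normal_density y + y * normal_cdf y)) (at y)" for y
      by (auto intro!: derivative_eq_intros simp: power2_eq_square algebra_simps)
    show "((\<lambda>w. (1 + w\<^sup>2) * normal_cdf w + w * std_normal_density w) \<longlongrightarrow> 0) at_bot"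
      using tendsto_add[OF tendsto_add[OF power_normal_cdf_at_bot[of 0] power_normal_cdf_at_bot[of 2]]
        std_normal_density_at_bot[of 1]] by (simp add: algebra_simps)
  qed (use density_plus_cdf_nonneg in \<open>auto simp del: distrib_left_numeral\<close>)
  moreover have "std_normal_density w > 0" by (simp add: normal_density_pos)
  ultimately show ?thesis by (simp add: mills_def field_simps)
qed

lemma mills_mult_mono:
  assumes "a \<le> b"
  shows "a * mills a \<le> b * mills b"
proof (rule DERIV_nonneg_imp_nondecreasing[OF assms])
  fix x
  have "((\<lambda>x. x * mills x) has_real_derivative mills x + x * (1 + x * mills x)) (at x)"
    by (auto intro!: derivative_eq_intros)
  moreover have "0 \<le> mills x + x * (1 + x * mills x)"
    using mills_upper[of x] by (simp add: algebra_simps power2_eq_square)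
  ultimately show "\<exists>y. ((\<lambda>x. x * mills x) has_real_derivative y) (at x) \<and> 0 \<le> y" by blast
qed

section \<open>The solution of Stein's equation for half-line indicators\<close>

lemma normal_cdf_minus: "normal_cdf (- z) = 1 - normal_cdf z"
proof -
  have "((\<lambda>z. normal_cdf (- z) + normal_cdf z) has_real_derivative 0) (at x)" for x
    by (auto intro!: derivative_eq_intros simp: normal_density_def)
  then have const: "normal_cdf (- x) + normal_cdf x = normal_cdf (- z) + normal_cdf z" for x
    by (rule DERIV_isconst_all[rule_format])
  have "((\<lambda>z. normal_cdf (- z)) \<longlongrightarrow> 0) at_top"
    using filterlim_compose[OF normal_cdf_at_bot filterlim_uminus_at_bot_at_top] .
  moreover have "(normal_cdf \<longlongrightarrow> 1) at_top"
    unfolding normal_cdf_eq_cdf by (rule std_normal.cdf_lim_at_top_prob)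
  ultimately have "((\<lambda>x. normal_cdf (- x) + normal_cdf x) \<longlongrightarrow> 0 + 1) at_top"
    by (rule tendsto_add)
  moreover have "(\<lambda>x. normal_cdf (- x) + normal_cdf x) = (\<lambda>x. normal_cdf (- z) + normal_cdf z)"
    by (rule ext) (rule const)
  ultimately show ?thesis by (simp add: tendsto_const_iff)
qed

text \<open>The bounded solution of
  \<open>f' w - w * f w = of_bool (w \<le> z) - normal_cdf z\<close>. By symmetry of the normal law,
  \<open>mills (- w)\<close> is the upper tail at \<open>w\<close> divided by the density, so the
  second branch is the classical one.\<close>

definition stein_sol :: "real \<Rightarrow> real \<Rightarrow> real" where
  "stein_sol z w = (if w \<le> z then (1 - normal_cdf z) * mills w else normal_cdf z * mills (- w))"

text \<open>At the kink \<open>w = z\<close> this is the left derivative of \<open>stein_sol z\<close>.\<close>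

definition stein_deriv :: "real \<Rightarrow> real \<Rightarrow> real" where
  "stein_deriv z w = w * stein_sol z w + of_bool (w \<le> z) - normal_cdf z"

lemma stein_sol_at_kink: "(1 - normal_cdf z) * mills z = normal_cdf z * mills (- z)"
  by (simp add: mills_def normal_cdf_minus normal_density_def)

lemma stein_sol_le: "w \<le> z \<Longrightarrow> stein_sol z w = (1 - normal_cdf z) * mills w"
  and stein_sol_ge: "z \<le> w \<Longrightarrow> stein_sol z w = normal_cdf z * mills (- w)"
  by (auto simp: stein_sol_def stein_sol_at_kink)

text \<open>Each branch inherits monotonicity from \<open>w * mills w\<close>, the right one after
  reflecting twice. The branches agree at \<open>z\<close>, so the two halves can be chained through
  that point.\<close>

lemma stein_sol_mult_mono:
  assumes "a \<le> b"
  shows "a * stein_sol z a \<le> b * stein_sol z b"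
proof -
  have left: "a * stein_sol z a \<le> b * stein_sol z b" if "a \<le> b" "b \<le> z" for a b
    using mult_left_mono[OF mills_mult_mono[OF that(1)], of "1 - normal_cdf z"] that
    by (simp add: stein_sol_le normal_cdf_le_1 algebra_simps)
  have right: "a * stein_sol z a \<le> b * stein_sol z b" if "a \<le> b" "z \<le> a" for a b
    using mult_left_mono[OF mills_mult_mono[of "-b" "-a"], of "normal_cdf z"] that
    by (simp add: stein_sol_ge normal_cdf_nonneg algebra_simps)
  show ?thesis
    using assms left[of a b] right[of a b] left[of a z] right[of z b] by linarith
qed

lemma stein_sol_mult_ge: "w \<le> z \<Longrightarrow> normal_cdf z - 1 \<le> w * stein_sol z w"
  using mult_left_mono[OF mills_lower[of w], of "1 - normal_cdf z"] normal_cdf_le_1[of z]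
  by (simp add: stein_sol_le algebra_simps)

lemma stein_sol_mult_le: "z \<le> w \<Longrightarrow> w * stein_sol z w \<le> normal_cdf z"
  using mult_left_mono[OF mills_lower[of "- w"], of "normal_cdf z"] normal_cdf_nonneg[of z]
  by (simp add: stein_sol_ge mult.left_commute)

text \<open>The Mills bound gives a lower estimate left of \<open>z\<close> and an upper one right
  of \<open>z\<close>; monotonicity carries each across \<open>z\<close>. Thus the product always
  lies between \<open>normal_cdf z - 1\<close> and \<open>normal_cdf z\<close>.\<close>

lemma stein_sol_mult_bounds: "\<bar>w * stein_sol z w\<bar> \<le> 1"
  using stein_sol_mult_ge[of w z] stein_sol_mult_ge[of z z] stein_sol_mult_le[of z w]
    stein_sol_mult_le[of z z] stein_sol_mult_mono[of z w z] stein_sol_mult_mono[of w z z]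
    normal_cdf_nonneg[of z] normal_cdf_le_1[of z]
  by linarith

lemma stein_deriv_bounds: "\<bar>stein_deriv z w\<bar> \<le> 1"
  using stein_sol_mult_ge[of w z] stein_sol_mult_ge[of z z] stein_sol_mult_le[of z w]
    stein_sol_mult_le[of z z] stein_sol_mult_mono[of z w z] stein_sol_mult_mono[of w z z]
    normal_cdf_nonneg[of z] normal_cdf_le_1[of z]
  by (cases "w \<le> z") (simp_all add: stein_deriv_def)

section \<open>Increments of the Stein solution\<close>

lemma diff_bounds_if_deriv_bounds:
  fixes g g' :: "real \<Rightarrow> real"
  assumes "a \<le> b" and deriv: "\<And>x. (g has_real_derivative g' x) (at x)"
    and "\<And>x. a \<le> x \<Longrightarrow> x \<le> b \<Longrightarrow> l \<le> g' x" "\<And>x. a \<le> x \<Longrightarrow> x \<le> b \<Longrightarrow> g' x \<le> u"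
  shows "(b - a) * l \<le> g b - g a" "g b - g a \<le> (b - a) * u"
proof -
  have "(b - a) * l \<le> g b - g a \<and> g b - g a \<le> (b - a) * u"
  proof (cases "a = b")
    case False
    then obtain x where "a < x" "x < b" "g b - g a = (b - a) * g' x"
      using MVT2[of a b g g'] assms(1) deriv by auto
    then show ?thesis using assms by (auto intro!: mult_left_mono)
  qed simp
  then show "(b - a) * l \<le> g b - g a" "g b - g a \<le> (b - a) * u" by auto
qed

text \<open>Off the kink the derivative is
  \<open>w * stein_sol z w + of_bool (w \<le> z) - normal_cdf z\<close>. The first summand increases
  and the indicator decreases in \<open>w\<close>, so each is bounded by its values at the end
  points.\<close>

lemma stein_sol_increment:
  assumes "a \<le> b"
  shows "(b - a) * (a * stein_sol z a + of_bool (b \<le> z) - normal_cdf z) \<le> stein_sol z b - stein_sol z a"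
    and "stein_sol z b - stein_sol z a \<le> (b - a) * (b * stein_sol z b + of_bool (a \<le> z) - normal_cdf z)"
proof -
  let ?p = "normal_cdf z" and ?f = "stein_sol z"
  have left: "(b - a) * (a * ?f a + 1 - ?p) \<le> ?f b - ?f a \<and>
      ?f b - ?f a \<le> (b - a) * (b * ?f b + 1 - ?p)" if ab: "a \<le> b" "b \<le> z" for a b
  proof -
    have d: "((\<lambda>w. (1 - ?p) * mills w) has_real_derivative (1 - ?p) * (1 + x * mills x)) (at x)" for x
      by (rule DERIV_cmult[OF mills_deriv])
    have e: "(1 - ?p) * (1 + x * mills x) = x * ?f x + 1 - ?p" if "x \<le> z" for x
      using that by (simp add: stein_sol_le algebra_simps)
    have "a * ?f a + 1 - ?p \<le> (1 - ?p) * (1 + x * mills x)"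
      "(1 - ?p) * (1 + x * mills x) \<le> b * ?f b + 1 - ?p" if "a \<le> x" "x \<le> b" for x
      using that ab stein_sol_mult_mono[of a x z] stein_sol_mult_mono[of x b z] by (simp_all add: e)
    from diff_bounds_if_deriv_bounds[OF ab(1) d this] show ?thesis
      using ab by (simp add: stein_sol_le)
  qed
  have right: "(b - a) * (a * ?f a - ?p) \<le> ?f b - ?f a \<and>
      ?f b - ?f a \<le> (b - a) * (b * ?f b - ?p)" if ab: "a \<le> b" "z \<le> a" for a b
  proof -
    have d: "((\<lambda>w. ?p * mills (- w)) has_real_derivative ?p * (x * mills (- x) - 1)) (at x)" for x
      using DERIV_cmult[OF DERIV_chain2[OF mills_deriv DERIV_minus[OF DERIV_ident]], of ?p x]
      by (simp add: algebra_simps)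
    have e: "?p * (x * mills (- x) - 1) = x * ?f x - ?p" if "z \<le> x" for x
      using that by (simp add: stein_sol_ge algebra_simps)
    have "a * ?f a - ?p \<le> ?p * (x * mills (- x) - 1)"
      "?p * (x * mills (- x) - 1) \<le> b * ?f b - ?p" if "a \<le> x" "x \<le> b" for x
      using that ab stein_sol_mult_mono[of a x z] stein_sol_mult_mono[of x b z] by (simp_all add: e)
    from diff_bounds_if_deriv_bounds[OF ab(1) d this] show ?thesis
      using ab by (simp add: stein_sol_ge)
  qed
  have "(b - a) * (a * ?f a + of_bool (b \<le> z) - ?p) \<le> ?f b - ?f a \<and>
    ?f b - ?f a \<le> (b - a) * (b * ?f b + of_bool (a \<le> z) - ?p)"
  proof (cases "b \<le> z \<or> z < a")
    case True
    then show ?thesis using left[of a b] right[of a b] assms by auto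
  next
    case False
    \<comment> \<open>Here \<open>a \<le> z < b\<close>, so the indicator is 0 in the lower and 1 in
      the upper bound. The estimates on \<open>[a, z]\<close> and \<open>[z, b]\<close> are weakened
      to these values and added.\<close>
    have "(z - a) * (a * ?f a - ?p) \<le> (z - a) * (a * ?f a + 1 - ?p)"
         "(b - z) * (a * ?f a - ?p) \<le> (b - z) * (z * ?f z - ?p)"
         "(z - a) * (z * ?f z + 1 - ?p) \<le> (z - a) * (b * ?f b + 1 - ?p)"
         "(b - z) * (b * ?f b - ?p) \<le> (b - z) * (b * ?f b + 1 - ?p)"
      using False stein_sol_mult_mono[of a z z] stein_sol_mult_mono[of z b z]
      by (intro mult_left_mono; simp)+
    then show ?thesis using False left[of a z] right[of z b] by (simp add: algebra_simps)
  qed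
  then show "(b - a) * (a * ?f a + of_bool (b \<le> z) - ?p) \<le> ?f b - ?f a"
    "?f b - ?f a \<le> (b - a) * (b * ?f b + of_bool (a \<le> z) - ?p)" by auto
qed

definition stein_mono :: "real \<Rightarrow> real \<Rightarrow> real" where
  "stein_mono z w = w * stein_sol z w - of_bool (w \<le> z)"

lemma stein_mono_bounds: "\<bar>stein_mono z w\<bar> \<le> 2"
  using stein_sol_mult_bounds[of w z] by (auto simp: stein_mono_def abs_le_iff)

text \<open>The increment and its linearisation at either end point lie between the two bounds of
  \<open>stein_sol_increment\<close>, and the gap between those bounds is exactly the increment of
  \<open>stein_mono\<close> times \<open>b - a\<close>.\<close>

lemma stein_sol_increment_approx:
  assumes "a \<le> b" and "w = a \<or> w = b"
  shows "\<bar>stein_sol z b - stein_sol z a - (b - a) * stein_deriv z w\<bar>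
    \<le> (b - a) * (stein_mono z b - stein_mono z a)"
proof -
  let ?p = "normal_cdf z" and ?f = "stein_sol z"
  have "(b - a) * (a * ?f a + of_bool (b \<le> z) - ?p) \<le> (b - a) * stein_deriv z w"
    "(b - a) * stein_deriv z w \<le> (b - a) * (b * ?f b + of_bool (a \<le> z) - ?p)"
    using assms stein_sol_mult_mono[OF assms(1), of z]
    by (auto simp: stein_deriv_def intro!: mult_left_mono)
  then show ?thesis
    using stein_sol_increment[OF assms(1), of z]
    by (simp add: stein_mono_def algebra_simps abs_le_iff)
qed

section \<open>Products of Bernoulli measures\<close>

definition bexp :: "'a set \<Rightarrow> ('a \<Rightarrow> real) \<Rightarrow> (('a \<Rightarrow> bool) \<Rightarrow> real) \<Rightarrow> real" where
  "bexp A p f = measure_pmf.expectation (Pi_pmf A False (\<lambda>e. bernoulli_pmf (p e))) f"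

definition flip_diff :: "'a \<Rightarrow> (('a \<Rightarrow> bool) \<Rightarrow> real) \<Rightarrow> ('a \<Rightarrow> bool) \<Rightarrow> real" where
  "flip_diff e f x = f (x(e := True)) - f (x(e := False))"

text \<open>Independence in the functional sense: the value of \<open>f\<close> does not read
  coordinate \<open>e\<close>. Under the product measure it allows the factor in coordinate
  \<open>e\<close> to be integrated out separately.\<close>

definition indep_of :: "'a \<Rightarrow> (('a \<Rightarrow> bool) \<Rightarrow> 'b) \<Rightarrow> bool" where
  "indep_of e f \<longleftrightarrow> (\<forall>x b. f (x(e := b)) = f x)"

lemma indep_ofD: "indep_of e f \<Longrightarrow> f (x(e := b)) = f x"
  by (simp add: indep_of_def)

lemma flip_diff_upd [simp]: "flip_diff e f (x(e := b)) = flip_diff e f x"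
  by (simp add: flip_diff_def)

lemma flip_diff_upd_commute:
  "e \<noteq> e' \<Longrightarrow> flip_diff e f (x(e' := b)) = flip_diff e (\<lambda>x. f (x(e' := b))) x"
  by (simp add: flip_diff_def fun_upd_twist)

lemma finite_set_Pi_bool: "finite A \<Longrightarrow> finite (set_pmf (Pi_pmf A False (p :: 'a \<Rightarrow> bool pmf)))"
  by (rule finite_subset[OF set_Pi_pmf_subset'[of A False p]]) (auto intro!: finite_PiE_dflt)

lemma bexp_integrable:
  "finite A \<Longrightarrow> integrable (measure_pmf (Pi_pmf A False (p :: 'a \<Rightarrow> bool pmf))) (f :: _ \<Rightarrow> real)"
  by (rule integrable_measure_pmf_finite[OF finite_set_Pi_bool])

lemma bexp_insert:
  assumes "finite A" "e \<notin> A" "0 \<le> p e" "p e \<le> 1"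
  shows "bexp (insert e A) p f =
    p e * bexp A p (\<lambda>x. f (x(e := True))) + (1 - p e) * bexp A p (\<lambda>x. f (x(e := False)))"
proof -
  have *: "Pi_pmf (insert e A) False (\<lambda>e. bernoulli_pmf (p e)) =
      bernoulli_pmf (p e) \<bind> (\<lambda>y. map_pmf (\<lambda>f. f(e := y)) (Pi_pmf A False (\<lambda>e. bernoulli_pmf (p e))))"
    using assms by (simp add: Pi_pmf_insert' map_pmf_def)
  show ?thesis
    unfolding bexp_def *
    by (subst pmf_expectation_bind[where A = UNIV])
       (use assms in \<open>auto simp: finite_set_Pi_bool UNIV_bool\<close>)
qed

section \<open>Integration by parts over independent coordinates\<close>

locale bernoulli_product =
  fixes A :: "'a set" and p :: "'a \<Rightarrow> real"
  assumes fin: "finite A" and p_nonneg: "e \<in> A \<Longrightarrow> 0 \<le> p e" and p_le_1: "e \<in> A \<Longrightarrow> p e \<le> 1"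
begin

abbreviation E :: "(('a \<Rightarrow> bool) \<Rightarrow> real) \<Rightarrow> real" where
  "E \<equiv> bexp A p"

abbreviation centred :: "'a \<Rightarrow> ('a \<Rightarrow> bool) \<Rightarrow> real" where
  "centred e x \<equiv> of_bool (x e) - p e"

lemma E_add: "E (\<lambda>x. f x + g x) = E f + E g"
  and E_diff: "E (\<lambda>x. f x - g x) = E f - E g"
  and E_cmult: "E (\<lambda>x. c * f x) = c * E f"
  and E_const: "E (\<lambda>x. c) = c"
  and E_sum: "E (\<lambda>x. \<Sum>i\<in>I. h i x) = (\<Sum>i\<in>I. E (h i))"
  unfolding bexp_def using fin by (simp_all add: bexp_integrable)

lemma E_mono: "(\<And>x. f x \<le> g x) \<Longrightarrow> E f \<le> E g"
  unfolding bexp_def using fin by (intro integral_mono) (simp_all add: bexp_integrable)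

lemma E_nonneg: "(\<And>x. 0 \<le> f x) \<Longrightarrow> 0 \<le> E f"
  using E_mono[of "\<lambda>_. 0" f] by (simp add: E_const)

lemma E_abs_le: "\<bar>E f\<bar> \<le> E (\<lambda>x. \<bar>f x\<bar>)"
  unfolding bexp_def by (rule integral_abs_bound)

lemma E_coord:
  assumes "e \<in> A"
  shows "E f = p e * E (\<lambda>x. f (x(e := True))) + (1 - p e) * E (\<lambda>x. f (x(e := False)))"
proof -
  have "bexp (insert e (A - {e})) p f = p e * bexp (A - {e}) p (\<lambda>x. f (x(e := True)))
      + (1 - p e) * bexp (A - {e}) p (\<lambda>x. f (x(e := False)))" for f
    using assms by (intro bexp_insert) (auto simp: fin p_nonneg p_le_1)
  then have *: "E f = p e * bexp (A - {e}) p (\<lambda>x. f (x(e := True)))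
      + (1 - p e) * bexp (A - {e}) p (\<lambda>x. f (x(e := False)))" for f
    using assms by (simp add: insert_absorb)
  \<comment> \<open>Once coordinate \<open>e\<close> is fixed, the integrand no longer reads it, so
    integrating over \<open>A\<close> or over \<open>A - {e}\<close> gives the same value.\<close>
  show ?thesis
    by (simp add: *[of "\<lambda>x. f (x(e := True))"] *[of "\<lambda>x. f (x(e := False))"])
       (simp add: *[of f] algebra_simps)
qed

text \<open>Discrete integration by parts: conditionally on the other coordinates, the centred
  indicator takes the values \<open>1 - p e\<close> and \<open>- p e\<close> with weights
  \<open>p e\<close> and \<open>1 - p e\<close>, which leaves a difference of \<open>f\<close> with
  factor \<open>p e * (1 - p e)\<close>.\<close>

lemma E_centred:
  assumes "e \<in> A" "indep_of e g"
  shows "E (\<lambda>x. centred e x * g x * f x) = p e * (1 - p e) * E (\<lambda>x. g x * flip_diff e f x)"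
proof -
  have "E (\<lambda>x. centred e x * g x * f x) =
      p e * E (\<lambda>x. (1 - p e) * (g x * f (x(e := True)))) +
      (1 - p e) * E (\<lambda>x. (- p e) * (g x * f (x(e := False))))"
    by (subst E_coord[OF assms(1)]) (simp add: indep_ofD[OF assms(2)] mult.assoc)
  also have "\<dots> = p e * (1 - p e) *
      (E (\<lambda>x. g x * f (x(e := True))) - E (\<lambda>x. g x * f (x(e := False))))"
    unfolding E_cmult by (simp add: algebra_simps)
  finally show ?thesis
    by (simp add: flip_diff_def right_diff_distrib E_diff)
qed

lemma E_centred_eq_0:
  assumes "e \<in> A" "indep_of e g"
  shows "E (\<lambda>x. centred e x * g x) = 0"
  using E_centred[OF assms, of "\<lambda>_. 1"] by (simp add: flip_diff_def E_const)

lemma E_coord_mult: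
  assumes "e \<in> A" "indep_of e g"
  shows "E (\<lambda>x. of_bool (x e) * g x) = p e * E g"
  by (subst E_coord[OF assms(1)]) (simp add: indep_ofD[OF assms(2)] E_const)

lemma E_square_le: "(E f)\<^sup>2 \<le> E (\<lambda>x. (f x)\<^sup>2)"
proof -
  have "0 \<le> E (\<lambda>x. (f x - E f)\<^sup>2)" by (rule E_nonneg) simp
  also have "(\<lambda>x. (f x - E f)\<^sup>2) = (\<lambda>x. (f x)\<^sup>2 - 2 * E f * f x + (E f)\<^sup>2)"
    by (simp add: power2_diff algebra_simps)
  also have "E \<dots> = E (\<lambda>x. (f x)\<^sup>2) - (E f)\<^sup>2"
    unfolding E_add E_diff E_cmult E_const by (simp add: power2_eq_square)
  finally show ?thesis by simp
qed

lemma E_abs_le_sqrt: "E (\<lambda>x. \<bar>f x\<bar>) \<le> sqrt (E (\<lambda>x. (f x)\<^sup>2))"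
  using E_square_le[of "\<lambda>x. \<bar>f x\<bar>"] by (intro real_le_rsqrt) simp

lemma prob_eq_E:
  "measure_pmf.prob (Pi_pmf A False (\<lambda>e. bernoulli_pmf (p e))) {x. P x} = E (\<lambda>x. of_bool (P x))"
proof -
  have "(\<lambda>x. of_bool (P x) :: real) = indicator {x. P x}" by (auto simp: indicator_def)
  then show ?thesis unfolding bexp_def by simp
qed

theorem stein_kolmogorov_bound:
  assumes W: "\<And>x. W x = (\<Sum>e\<in>A. centred e x * \<gamma> e x)"
    and indep: "\<And>e. e \<in> A \<Longrightarrow> indep_of e (\<gamma> e)"
    and \<gamma>_nonneg: "\<And>e x. e \<in> A \<Longrightarrow> 0 \<le> \<gamma> e x"
    and D_nonneg: "\<And>e x. e \<in> A \<Longrightarrow> 0 \<le> flip_diff e W x"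
  shows "\<bar>measure_pmf.prob (Pi_pmf A False (\<lambda>e. bernoulli_pmf (p e))) {x. W x \<le> z} - normal_cdf z\<bar>
    \<le> E (\<lambda>x. \<bar>1 - (\<Sum>e\<in>A. p e * (1 - p e) * (\<gamma> e x * flip_diff e W x))\<bar>)
      + 2 * E (\<lambda>x. \<bar>\<Sum>e\<in>A. centred e x * (\<gamma> e x * flip_diff e W x)\<bar>)"
proof -
  let ?f = "stein_sol z" and ?f' = "stein_deriv z" and ?h = "stein_mono z"
  let ?U = "\<lambda>x. \<Sum>e\<in>A. p e * (1 - p e) * (\<gamma> e x * flip_diff e W x)"
  let ?V = "\<lambda>x. \<Sum>e\<in>A. centred e x * (\<gamma> e x * flip_diff e W x)"
  have q: "0 \<le> p e * (1 - p e)" if "e \<in> A" for e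
    using p_nonneg[OF that] p_le_1[OF that] by simp
  \<comment> \<open>By the choice of \<open>stein_deriv\<close>, Stein's equation holds pointwise,
    also at the kink; this is its expectation at \<open>W\<close>.\<close>
  have "measure_pmf.prob (Pi_pmf A False (\<lambda>e. bernoulli_pmf (p e))) {x. W x \<le> z} - normal_cdf z
      = E (\<lambda>x. ?f' (W x)) - E (\<lambda>x. W x * ?f (W x))"
    by (simp add: prob_eq_E stein_deriv_def E_add E_diff E_const)
  also have "E (\<lambda>x. W x * ?f (W x)) = (\<Sum>e\<in>A. E (\<lambda>x. centred e x * \<gamma> e x * ?f (W x)))"
    by (simp add: W sum_distrib_right E_sum)
  also have "\<dots> = (\<Sum>e\<in>A. p e * (1 - p e) * E (\<lambda>x. \<gamma> e x * flip_diff e (\<lambda>x. ?f (W x)) x))"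
    by (intro sum.cong refl E_centred indep)
  also have "\<dots> = E (\<lambda>x. \<Sum>e\<in>A. p e * (1 - p e) * (\<gamma> e x * flip_diff e (\<lambda>x. ?f (W x)) x))"
    by (simp add: E_sum E_cmult)
  finally have eq: "measure_pmf.prob (Pi_pmf A False (\<lambda>e. bernoulli_pmf (p e))) {x. W x \<le> z} - normal_cdf z
      = E (\<lambda>x. ?f' (W x)) - E (\<lambda>x. \<Sum>e\<in>A. p e * (1 - p e) * (\<gamma> e x * flip_diff e (\<lambda>x. ?f (W x)) x))"
    (is "?L = _ - E ?G") .
  have pointwise: "\<bar>flip_diff e (\<lambda>x. ?f (W x)) x - flip_diff e W x * ?f' (W x)\<bar>
      \<le> flip_diff e W x * flip_diff e (\<lambda>x. ?h (W x)) x" if "e \<in> A" for e x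
  proof -
    \<comment> \<open>The configuration \<open>x\<close> is itself one of the two flipped ones, so
      the linearisation is taken at an end point of the increment.\<close>
    have "W x = W (x(e := False)) \<or> W x = W (x(e := True))"
      by (cases "x e") (simp_all add: fun_upd_idem)
    moreover have "W (x(e := False)) \<le> W (x(e := True))"
      using D_nonneg[OF that, of x] by (simp add: flip_diff_def)
    ultimately show ?thesis
      unfolding flip_diff_def by (intro stein_sol_increment_approx) auto
  qed
  let ?R = "\<lambda>x. \<Sum>e\<in>A. p e * (1 - p e) * (\<gamma> e x * (flip_diff e W x * flip_diff e (\<lambda>x. ?h (W x)) x))"
  have approx: "\<bar>?f' (W x) - ?G x - ?f' (W x) * (1 - ?U x)\<bar> \<le> ?R x" for x
  proof -
    have "?f' (W x) - ?G x - ?f' (W x) * (1 - ?U x) = (\<Sum>e\<in>A. p e * (1 - p e) *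
        (\<gamma> e x * (flip_diff e W x * ?f' (W x) - flip_diff e (\<lambda>x. ?f (W x)) x)))"
      by (simp add: algebra_simps sum_distrib_left sum_subtractf sum.distrib)
    also have "\<bar>\<dots>\<bar> \<le> ?R x"
      using p_nonneg p_le_1 \<gamma>_nonneg pointwise
      by (intro order_trans[OF sum_abs] sum_mono)
         (auto simp: abs_mult abs_minus_commute intro!: mult_left_mono)
    finally show ?thesis .
  qed
  have triangle: "\<bar>a\<bar> \<le> u + r" if "\<bar>a - c\<bar> \<le> r" "\<bar>c\<bar> \<le> u" for a c r u :: real
    using that by linarith
  have "\<bar>?f' (W x) * (1 - ?U x)\<bar> \<le> \<bar>1 - ?U x\<bar>" for x
    using mult_right_mono[OF stein_deriv_bounds[of z "W x"], of "\<bar>1 - ?U x\<bar>"]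
    by (simp add: abs_mult)
  then have "\<bar>?f' (W x) - ?G x\<bar> \<le> \<bar>1 - ?U x\<bar> + ?R x" for x
    by (rule triangle[OF approx])
  then have "\<bar>?L\<bar> \<le> E (\<lambda>x. \<bar>1 - ?U x\<bar> + ?R x)"
    unfolding eq E_diff[symmetric] by (intro order_trans[OF E_abs_le] E_mono)
  also have "\<dots> = E (\<lambda>x. \<bar>1 - ?U x\<bar>) + E ?R"
    by (rule E_add)
  \<comment> \<open>Integration by parts is used backwards: neither \<open>\<gamma> e\<close> nor
    the difference of \<open>W\<close> reads coordinate \<open>e\<close>. The differences of
    \<open>stein_mono\<close> disappear and only its bound 2 matters.\<close>
  also have "E ?R = E (\<lambda>x. ?V x * ?h (W x))"
  proof -
    have "indep_of e (\<lambda>x. \<gamma> e x * flip_diff e W x)" if "e \<in> A" for e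
      using indep[OF that] by (simp add: indep_of_def)
    then have "(\<Sum>e\<in>A. E (\<lambda>x. centred e x * (\<gamma> e x * flip_diff e W x) * ?h (W x))) =
        (\<Sum>e\<in>A. p e * (1 - p e) * E (\<lambda>x. (\<gamma> e x * flip_diff e W x) * flip_diff e (\<lambda>x. ?h (W x)) x))"
      by (intro sum.cong refl E_centred)
    then show ?thesis
      by (simp add: E_sum E_cmult sum_distrib_right mult.assoc)
  qed
  also have "\<dots> \<le> E (\<lambda>x. 2 * \<bar>?V x\<bar>)"
  proof (rule E_mono)
    fix x
    have "?V x * ?h (W x) \<le> \<bar>?V x\<bar> * \<bar>?h (W x)\<bar>" by (simp add: abs_mult[symmetric])
    also have "\<dots> \<le> \<bar>?V x\<bar> * 2" by (intro mult_left_mono stein_mono_bounds) auto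
    finally show "?V x * ?h (W x) \<le> 2 * \<bar>?V x\<bar>" by simp
  qed
  finally show ?thesis by (simp add: E_cmult)
qed

text \<open>A discrete form of the Skorokhod isometry. Diagonal terms are integrated by parts once.
  Off the diagonal a second integration by parts leaves a product of two cross differences, which
  \<open>2 a b \<le> a^2 + b^2\<close> separates.\<close>

lemma E_divergence_square:
  assumes indep: "\<And>e. e \<in> A \<Longrightarrow> indep_of e (h e)"
  shows "E (\<lambda>x. (\<Sum>e\<in>A. centred e x * h e x)\<^sup>2) \<le> (\<Sum>e\<in>A. p e * E (\<lambda>x. (h e x)\<^sup>2))
    + (\<Sum>e\<in>A. \<Sum>e'\<in>A - {e}. p e * p e' * E (\<lambda>x. (flip_diff e' (h e) x)\<^sup>2))"
proof -
  define T where "T e e' = E (\<lambda>x. centred e x * h e x * (centred e' x * h e' x))" for e e'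
  define B where "B e e' = p e * p e' * E (\<lambda>x. (flip_diff e' (h e) x)\<^sup>2)" for e e'
  have diag: "T e e \<le> p e * E (\<lambda>x. (h e x)\<^sup>2)" if "e \<in> A" for e
  proof -
    have "T e e = p e * (1 - p e) * E (\<lambda>x. h e x * flip_diff e (\<lambda>x. centred e x * h e x) x)"
      unfolding T_def by (rule E_centred[OF that indep[OF that]])
    also have "(\<lambda>x. h e x * flip_diff e (\<lambda>x. centred e x * h e x) x) = (\<lambda>x. (h e x)\<^sup>2)"
      by (rule ext) (simp add: flip_diff_def indep_ofD[OF indep[OF that]] power2_eq_square algebra_simps)
    also have "p e * (1 - p e) * E (\<lambda>x. (h e x)\<^sup>2) \<le> p e * E (\<lambda>x. (h e x)\<^sup>2)"
      using p_nonneg[OF that] by (intro mult_right_mono E_nonneg) (auto simp: mult_left_le)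
    finally show ?thesis .
  qed
  have off: "T e e' \<le> (B e e' + B e' e) / 2" if "e \<in> A" "e' \<in> A" "e \<noteq> e'" for e e'
  proof -
    let ?c = "p e * (1 - p e) * (p e' * (1 - p e'))"
    have c: "0 \<le> ?c" "?c \<le> p e * p e'"
      using that p_nonneg p_le_1 by (auto intro!: mult_mono mult_left_le)
    have "T e e' = p e * (1 - p e) * E (\<lambda>x. h e x * flip_diff e (\<lambda>x. centred e' x * h e' x) x)"
      unfolding T_def by (rule E_centred[OF that(1) indep[OF that(1)]])
    also have "(\<lambda>x. h e x * flip_diff e (\<lambda>x. centred e' x * h e' x) x) =
        (\<lambda>x. centred e' x * flip_diff e (h e') x * h e x)"
      using that by (intro ext) (simp add: flip_diff_def algebra_simps)
    \<comment> \<open>The difference \<open>flip_diff e (h e')\<close> does not read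
      \<open>e'\<close> either, so integration by parts applies once more, now in coordinate
      \<open>e'\<close>.\<close>
    also have "E \<dots> = p e' * (1 - p e') * E (\<lambda>x. flip_diff e (h e') x * flip_diff e' (h e) x)"
      using that indep_ofD[OF indep[OF that(2)]]
      by (intro E_centred) (auto simp: indep_of_def flip_diff_def fun_upd_twist[of e' e])
    also have "p e * (1 - p e) * \<dots> = ?c * E (\<lambda>x. flip_diff e (h e') x * flip_diff e' (h e) x)"
      by simp
    also have "\<dots> \<le> ?c * E (\<lambda>x. ((flip_diff e (h e') x)\<^sup>2 + (flip_diff e' (h e) x)\<^sup>2) / 2)"
      using c(1) by (intro mult_left_mono E_mono) (simp add: sum_squares_bound mult.commute[of _ 2] mult.assoc[symmetric])
    also have "\<dots> \<le> p e * p e' * E (\<lambda>x. ((flip_diff e (h e') x)\<^sup>2 + (flip_diff e' (h e) x)\<^sup>2) / 2)"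
      by (intro mult_right_mono E_nonneg c) auto
    also have "\<dots> = (B e e' + B e' e) / 2"
      unfolding B_def using E_cmult[of "1/2" "\<lambda>x. (flip_diff e (h e') x)\<^sup>2 + (flip_diff e' (h e) x)\<^sup>2"]
      by (simp add: E_add algebra_simps add_divide_distrib)
    finally show ?thesis .
  qed
  have "E (\<lambda>x. (\<Sum>e\<in>A. centred e x * h e x)\<^sup>2) = (\<Sum>e\<in>A. \<Sum>e'\<in>A. T e e')"
    by (simp add: power2_eq_square sum_product E_sum T_def)
  also have "\<dots> = (\<Sum>e\<in>A. T e e + (\<Sum>e'\<in>A - {e}. T e e'))"
    by (intro sum.cong refl sum.remove fin)
  also have "\<dots> \<le> (\<Sum>e\<in>A. p e * E (\<lambda>x. (h e x)\<^sup>2) + (\<Sum>e'\<in>A - {e}. (B e e' + B e' e) / 2))"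
    by (intro sum_mono add_mono diag off) auto
  also have "\<dots> = (\<Sum>e\<in>A. p e * E (\<lambda>x. (h e x)\<^sup>2)) + (\<Sum>e\<in>A. \<Sum>e'\<in>A - {e}. B e e')"
  proof -
    \<comment> \<open>Renaming the indices shows that the two halves of the symmetrised bound have
      the same total.\<close>
    have "(\<Sum>e\<in>A. \<Sum>e'\<in>A - {e}. B e' e) = (\<Sum>e'\<in>A. \<Sum>e\<in>A - {e'}. B e' e)"
    proof -
      have "(\<Sum>e\<in>A. \<Sum>e'\<in>A - {e}. B e' e) = (\<Sum>e\<in>A. \<Sum>e'\<in>A. if e' = e then 0 else B e' e)"
        by (intro sum.cong refl sum.mono_neutral_cong_left) (auto simp: fin)
      also have "\<dots> = (\<Sum>e'\<in>A. \<Sum>e\<in>A. if e' = e then 0 else B e' e)"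
        by (rule sum.swap)
      also have "\<dots> = (\<Sum>e'\<in>A. \<Sum>e\<in>A - {e'}. B e' e)"
        by (intro sum.cong refl sum.mono_neutral_cong_right) (auto simp: fin)
      finally show ?thesis .
    qed
    then show ?thesis
      by (simp add: sum.distrib sum_divide_distrib[symmetric] add_divide_distrib)
  qed
  finally show ?thesis unfolding B_def .
qed

end

text \<open>The Efron-Stein inequality, by adding one coordinate at a time. It stands outside the
  locale because the induction varies the index set.\<close>

theorem bernoulli_poincare:
  assumes "finite A" "\<And>e. e \<in> A \<Longrightarrow> 0 \<le> p e" "\<And>e. e \<in> A \<Longrightarrow> p e \<le> 1"
  shows "bexp A p (\<lambda>x. (f x)\<^sup>2) - (bexp A p f)\<^sup>2
    \<le> (\<Sum>e\<in>A. p e * (1 - p e) * bexp A p (\<lambda>x. (flip_diff e f x)\<^sup>2))"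
  using assms
proof (induction A arbitrary: f rule: finite_induct)
  case empty
  then show ?case by (simp add: bexp_def)
next
  case (insert a A)
  interpret bernoulli_product A p
    using insert by unfold_locales auto
  have pa: "0 \<le> p a" "p a \<le> 1" using insert by auto
  let ?f1 = "\<lambda>x. f (x(a := True))" and ?f0 = "\<lambda>x. f (x(a := False))"
  have ins: "bexp (insert a A) p g = p a * E (\<lambda>x. g (x(a := True))) + (1 - p a) * E (\<lambda>x. g (x(a := False)))"
    for g using insert by (intro bexp_insert) auto
  have IH: "E (\<lambda>x. (g x)\<^sup>2) - (E g)\<^sup>2 \<le> (\<Sum>e\<in>A. p e * (1 - p e) * E (\<lambda>x. (flip_diff e g x)\<^sup>2))" for g
    using insert by auto
  \<comment> \<open>Law of total variance given coordinate \<open>a\<close>: the mean of the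
    conditional variances plus the variance of a two-valued conditional mean. Jensen's inequality
    handles the latter.\<close>
  have split: "bexp (insert a A) p (\<lambda>x. (f x)\<^sup>2) - (bexp (insert a A) p f)\<^sup>2 =
      p a * (E (\<lambda>x. (?f1 x)\<^sup>2) - (E ?f1)\<^sup>2) + (1 - p a) * (E (\<lambda>x. (?f0 x)\<^sup>2) - (E ?f0)\<^sup>2)
      + p a * (1 - p a) * (E (\<lambda>x. ?f1 x - ?f0 x))\<^sup>2"
    unfolding ins E_diff by (simp add: algebra_simps power2_eq_square)
  have last: "bexp (insert a A) p (\<lambda>x. (flip_diff a f x)\<^sup>2) = E (\<lambda>x. (?f1 x - ?f0 x)\<^sup>2)"
    unfolding ins by (simp add: flip_diff_def algebra_simps)
  have rest: "bexp (insert a A) p (\<lambda>x. (flip_diff e f x)\<^sup>2) =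
      p a * E (\<lambda>x. (flip_diff e ?f1 x)\<^sup>2) + (1 - p a) * E (\<lambda>x. (flip_diff e ?f0 x)\<^sup>2)" if "e \<in> A" for e
  proof -
    from that insert have "e \<noteq> a" by auto
    then show ?thesis unfolding ins by (simp add: flip_diff_upd_commute)
  qed
  have "p a * (E (\<lambda>x. (?f1 x)\<^sup>2) - (E ?f1)\<^sup>2) + (1 - p a) * (E (\<lambda>x. (?f0 x)\<^sup>2) - (E ?f0)\<^sup>2)
      + p a * (1 - p a) * (E (\<lambda>x. ?f1 x - ?f0 x))\<^sup>2
    \<le> p a * (\<Sum>e\<in>A. p e * (1 - p e) * E (\<lambda>x. (flip_diff e ?f1 x)\<^sup>2))
      + (1 - p a) * (\<Sum>e\<in>A. p e * (1 - p e) * E (\<lambda>x. (flip_diff e ?f0 x)\<^sup>2))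
      + p a * (1 - p a) * E (\<lambda>x. (?f1 x - ?f0 x)\<^sup>2)"
    using pa by (intro add_mono mult_left_mono IH E_square_le) auto
  also have "\<dots> = (\<Sum>e\<in>insert a A. p e * (1 - p e) * bexp (insert a A) p (\<lambda>x. (flip_diff e f x)\<^sup>2))"
    using insert.hyps
    by (simp add: last rest sum_distrib_left sum.distrib[symmetric] algebra_simps cong: sum.cong)
  finally show ?case unfolding split .
qed

section \<open>Triangles and common neighbours\<close>

text \<open>The ordered representative of an unordered pair in the encoding of graphs; it allows
  edges to be named without knowing which end point is smaller.\<close>

definition edge :: "nat \<Rightarrow> nat \<Rightarrow> nat \<times> nat" where
  "edge i j = (min i j, max i j)"

lemma edge_commute: "edge i j = edge j i"
  by (simp add: edge_def min.commute max.commute)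

lemma edge_eq_iff: "edge i j = edge k l \<longleftrightarrow> i = k \<and> j = l \<or> i = l \<and> j = k"
  by (auto simp: edge_def min_def max_def)

lemma edge_eq_pair: "i < j \<Longrightarrow> edge i j = (i, j)"
  by (simp add: edge_def)

lemma edge_ind_commute: "edge_ind i j g = edge_ind j i g"
  by (simp add: edge_ind_def min.commute max.commute)

lemma edge_ind_upd:
  "edge_ind i j (g(e := b)) = (if e = edge i j then of_bool b else edge_ind i j g)"
  by (auto simp: edge_ind_def edge_def)

lemma edge_ind_bounds: "0 \<le> edge_ind i j g" "edge_ind i j g \<le> 1"
  by (auto simp: edge_ind_def)

lemma edge_prob_commute: "edge_prob m i j = edge_prob m j i"
  by (simp add: edge_prob_def mult.commute)

section \<open>Sums over pairs and triples of vertices\<close>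

lemma finite_vertex_pairs: "finite (vertex_pairs n)"
  by (rule finite_subset[of _ "{1..n} \<times> {1..n}"]) (auto simp: vertex_pairs_def)

lemma edge_in_vertex_pairs: "i \<in> {1..n} \<Longrightarrow> j \<in> {1..n} \<Longrightarrow> i \<noteq> j \<Longrightarrow> edge i j \<in> vertex_pairs n"
  by (auto simp: edge_def vertex_pairs_def min_def max_def)

lemma sum_vertex_pairs_third:
  fixes F :: "nat \<Rightarrow> nat \<Rightarrow> nat \<Rightarrow> 'b :: comm_monoid_add"
  shows "(\<Sum>(i, j) \<in> vertex_pairs n. \<Sum>k \<in> {1..n} - {i, j}. F i j k) =
    (\<Sum>(i, j, k) \<in> {(i, j, k). 1 \<le> i \<and> i < j \<and> j < k \<and> k \<le> n}. F i j k + F i k j + F j k i)"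
proof -
  \<comment> \<open>The three sets distinguish whether the third vertex lies above, between or below
    the two end points of the pair.\<close>
  define D1 where "D1 = {((i, j), k). 1 \<le> i \<and> i < j \<and> j < k \<and> k \<le> n}"
  define D2 where "D2 = {((i, j), k). 1 \<le> i \<and> i < k \<and> k < j \<and> j \<le> n}"
  define D3 where "D3 = {((i, j), k). 1 \<le> k \<and> k < i \<and> i < j \<and> j \<le> n}"
  let ?T = "{(i, j, k). 1 \<le> i \<and> i < j \<and> j < k \<and> k \<le> n}"
  let ?F = "\<lambda>((i, j), k). F i j k"
  have fin: "finite D1" "finite D2" "finite D3"
    by (rule finite_subset[of _ "({1..n} \<times> {1..n}) \<times> {1..n}"]; auto simp: D1_def D2_def D3_def)+
  have "(\<Sum>(i, j) \<in> vertex_pairs n. \<Sum>k \<in> {1..n} - {i, j}. F i j k) =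
      (\<Sum>e \<in> vertex_pairs n. \<Sum>k \<in> {1..n} - {fst e, snd e}. F (fst e) (snd e) k)"
    by (simp add: case_prod_unfold)
  also have "\<dots> = sum ?F (SIGMA e:vertex_pairs n. {1..n} - {fst e, snd e})"
    by (subst sum.Sigma) (auto simp: finite_vertex_pairs case_prod_unfold)
  also have "(SIGMA e:vertex_pairs n. {1..n} - {fst e, snd e}) = D1 \<union> D2 \<union> D3"
    by (auto simp: vertex_pairs_def D1_def D2_def D3_def)
  also have "sum ?F \<dots> = sum ?F D1 + sum ?F D2 + sum ?F D3"
    using fin by (subst sum.union_disjoint sum.union_disjoint; auto simp: D1_def D2_def D3_def)+
  also have "sum ?F D1 = (\<Sum>(i, j, k) \<in> ?T. F i j k)"
    by (rule sum.reindex_bij_witness[where i = "\<lambda>(i, j, k). ((i, j), k)" and j = "\<lambda>((i, j), k). (i, j, k)"])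
       (auto simp: D1_def)
  also have "sum ?F D2 = (\<Sum>(i, j, k) \<in> ?T. F i k j)"
    by (rule sum.reindex_bij_witness[where i = "\<lambda>(i, j, k). ((i, k), j)" and j = "\<lambda>((i, k), j). (i, j, k)"])
       (auto simp: D2_def)
  also have "sum ?F D3 = (\<Sum>(i, j, k) \<in> ?T. F j k i)"
    by (rule sum.reindex_bij_witness[where i = "\<lambda>(i, j, k). ((j, k), i)" and j = "\<lambda>((j, k), i). (i, j, k)"])
       (auto simp: D3_def)
  finally show ?thesis by (simp add: case_prod_unfold sum.distrib)
qed

lemma sum_vertex_pairs_sym:
  fixes f :: "nat \<Rightarrow> nat \<Rightarrow> real"
  shows "(\<Sum>(i, j) \<in> vertex_pairs n. f i j + f j i) = (\<Sum>i = 1..n. \<Sum>j \<in> {1..n} - {i}. f i j)"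
proof -
  let ?D = "{(i, j). 1 \<le> j \<and> j < i \<and> i \<le> n}"
  have fin: "finite ?D"
    by (rule finite_subset[of _ "{1..n} \<times> {1..n}"]) auto
  have "(\<Sum>i = 1..n. \<Sum>j \<in> {1..n} - {i}. f i j) =
      (\<Sum>(i, j) \<in> (SIGMA i:{1..n}. {1..n} - {i}). f i j)"
    by (subst sum.Sigma) auto
  also have "(SIGMA i:{1..n}. {1..n} - {i}) = vertex_pairs n \<union> ?D"
    by (auto simp: vertex_pairs_def)
  also have "(\<Sum>(i, j) \<in> vertex_pairs n \<union> ?D. f i j) =
      (\<Sum>(i, j) \<in> vertex_pairs n. f i j) + (\<Sum>(i, j) \<in> ?D. f i j)"
    by (rule sum.union_disjoint[OF finite_vertex_pairs fin]) (auto simp: vertex_pairs_def)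
  also have "(\<Sum>(i, j) \<in> ?D. f i j) = (\<Sum>(i, j) \<in> vertex_pairs n. f j i)"
    by (rule sum.reindex_bij_witness[where i = prod.swap and j = prod.swap])
       (auto simp: vertex_pairs_def)
  finally show ?thesis by (simp add: case_prod_unfold sum.distrib)
qed

lemma sum_vertex_pairs_sym_le:
  fixes f :: "nat \<Rightarrow> nat \<Rightarrow> real"
  assumes "\<And>i j. i \<in> {1..n} \<Longrightarrow> j \<in> {1..n} \<Longrightarrow> 0 \<le> f i j"
  shows "(\<Sum>(i, j) \<in> vertex_pairs n. f i j + f j i) \<le> (\<Sum>i = 1..n. \<Sum>j = 1..n. f i j)"
  unfolding sum_vertex_pairs_sym using assms by (intro sum_mono sum_mono2) auto

lemma sum_vertex_pairs_le:
  fixes f :: "nat \<Rightarrow> nat \<Rightarrow> real"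
  assumes "\<And>i j. i \<in> {1..n} \<Longrightarrow> j \<in> {1..n} \<Longrightarrow> 0 \<le> f i j"
  shows "(\<Sum>(i, j) \<in> vertex_pairs n. f i j) \<le> (\<Sum>i = 1..n. \<Sum>j = 1..n. f i j)"
proof -
  have "(\<Sum>(i, j) \<in> vertex_pairs n. f i j) \<le> (\<Sum>(i, j) \<in> vertex_pairs n. f i j + f j i)"
    using assms by (intro sum_mono) (auto simp: vertex_pairs_def)
  also have "\<dots> \<le> (\<Sum>i = 1..n. \<Sum>j = 1..n. f i j)"
    by (rule sum_vertex_pairs_sym_le[OF assms])
  finally show ?thesis .
qed

text \<open>Intended for quantities that vanish unless an edge shares exactly one end point with
  \<open>{i, j}\<close>. Such edges are listed by their other end point \<open>k\<close>, and any
  overlap of the two lists is dropped by nonnegativity.\<close>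

lemma sum_adjacent_edges_le:
  fixes \<phi> :: "nat \<times> nat \<Rightarrow> real"
  assumes ij: "i \<in> {1..n}" "j \<in> {1..n}" and F: "F \<subseteq> vertex_pairs n"
    and nonneg: "\<And>e. e \<in> vertex_pairs n \<Longrightarrow> 0 \<le> \<phi> e"
    and zero: "\<And>e. e \<in> F \<Longrightarrow> e \<notin> edge i ` ({1..n} - {i, j}) \<Longrightarrow> e \<notin> edge j ` ({1..n} - {i, j}) \<Longrightarrow> \<phi> e = 0"
  shows "sum \<phi> F \<le> (\<Sum>k \<in> {1..n} - {i, j}. \<phi> (edge i k) + \<phi> (edge j k))"
proof -
  let ?L = "{1..n} - {i, j}"
  have inj: "inj_on (edge i) ?L" "inj_on (edge j) ?L"
    by (auto simp: inj_on_def edge_eq_iff)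
  have sub: "edge i ` ?L \<subseteq> vertex_pairs n" "edge j ` ?L \<subseteq> vertex_pairs n"
    using ij by (auto intro!: edge_in_vertex_pairs)
  have "sum \<phi> F = sum \<phi> (F \<inter> (edge i ` ?L \<union> edge j ` ?L))"
    by (rule sum.mono_neutral_right) (use finite_subset[OF F finite_vertex_pairs] zero in auto)
  also have "\<dots> \<le> sum \<phi> (edge i ` ?L \<union> edge j ` ?L)"
    by (rule sum_mono2, simp, blast) (use nonneg sub in blast)
  also have "\<dots> = sum \<phi> (edge i ` ?L) + sum \<phi> (edge j ` ?L) - sum \<phi> (edge i ` ?L \<inter> edge j ` ?L)"
    by (rule sum_Un) auto
  also have "\<dots> \<le> sum \<phi> (edge i ` ?L) + sum \<phi> (edge j ` ?L)"
  proof -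
    have "0 \<le> sum \<phi> (edge i ` ?L \<inter> edge j ` ?L)"
      by (rule sum_nonneg) (use nonneg sub in blast)
    then show ?thesis by linarith
  qed
  also have "\<dots> = (\<Sum>k \<in> ?L. \<phi> (edge i k) + \<phi> (edge j k))"
    using inj by (simp add: sum.reindex sum.distrib)
  finally show ?thesis .
qed

section \<open>Edge weights and common neighbours in the beta-model\<close>

locale beta_graph =
  fixes n :: nat and m :: "nat \<Rightarrow> real"
  assumes m_pos: "i \<in> {1..n} \<Longrightarrow> 0 < m i"
begin

abbreviation pr :: "nat \<Rightarrow> nat \<Rightarrow> real" where
  "pr \<equiv> edge_prob m"

definition pe :: "nat \<times> nat \<Rightarrow> real" where
  "pe = (\<lambda>(i, j). edge_prob m i j)"

lemma pe_edge: "pe (edge i j) = pr i j"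
  by (auto simp: pe_def edge_def min_def max_def edge_prob_commute)

lemma pr_bounds:
  assumes "i \<in> {1..n}" "j \<in> {1..n}"
  shows "0 \<le> pr i j" "pr i j \<le> 1" "pr i j \<le> m i * m j"
  using m_pos[OF assms(1)] m_pos[OF assms(2)]
  by (auto simp: edge_prob_def divide_le_eq mult_le_cancel_left1 add_pos_pos)

sublocale bernoulli_product "vertex_pairs n" pe
  by unfold_locales
     (simp add: finite_vertex_pairs, use pr_bounds in \<open>auto simp: vertex_pairs_def pe_def\<close>)

lemma beta_model_eq: "beta_model n m = Pi_pmf (vertex_pairs n) False (\<lambda>e. bernoulli_pmf (pe e))"
  by (simp add: beta_model_def pe_def case_prod_unfold)

lemma expectation_beta_model: "measure_pmf.expectation (beta_model n m) f = E f"
  by (simp add: bexp_def beta_model_eq)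

definition nbr :: "nat \<Rightarrow> nat \<Rightarrow> (nat \<times> nat \<Rightarrow> bool) \<Rightarrow> real" where
  "nbr i j g = (\<Sum>k \<in> {1..n} - {i, j}. edge_ind i k g * edge_ind j k g)"

text \<open>
  With \<open>a\<close>, \<open>b\<close>, \<open>c\<close> the edge indicators of a triangle and \<open>p\<close>, \<open>q\<close>, \<open>r\<close> their
  probabilities, \<open>a b c - p q r\<close> telescopes in six ways, one for each order in which indicators are
  replaced by probabilities; \<open>wt_term\<close> is the average of the six factors of \<open>c - r\<close>.
\<close>

definition wt_term :: "nat \<Rightarrow> nat \<Rightarrow> nat \<Rightarrow> (nat \<times> nat \<Rightarrow> bool) \<Rightarrow> real" where
  "wt_term i j k g = edge_ind i k g * edge_ind j k g / 3
     + (pr i k * edge_ind j k g + pr j k * edge_ind i k g) / 6 + pr i k * pr j k / 3"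

definition wt :: "nat \<Rightarrow> nat \<Rightarrow> (nat \<times> nat \<Rightarrow> bool) \<Rightarrow> real" where
  "wt i j g = (\<Sum>k \<in> {1..n} - {i, j}. wt_term i j k g)"

text \<open>The product \<open>g_e N_e\<close> of the outline, with \<open>wt\<close> as
  \<open>g_e\<close> and \<open>nbr\<close> as \<open>N_e\<close>.\<close>

definition wn :: "nat \<times> nat \<Rightarrow> (nat \<times> nat \<Rightarrow> bool) \<Rightarrow> real" where
  "wn = (\<lambda>(i, j) g. wt i j g * nbr i j g)"

text \<open>
  The normalisation gives \<open>Z\<close> values in the unit interval and the same mean as the edge indicator,
  while up to a factor of 2 it dominates both the indicator and the edge probability.
\<close>

definition Z :: "nat \<Rightarrow> nat \<Rightarrow> (nat \<times> nat \<Rightarrow> bool) \<Rightarrow> real" where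
  "Z i j g = (edge_ind i j g + pr i j) / 2"

text \<open>A majorant, up to constants, of both \<open>nbr\<close> and \<open>wt\<close>. The
  vertex set is a parameter: leaving out a vertex other than \<open>i\<close> and \<open>j\<close>
  makes the sum independent of all edges at that vertex.\<close>

definition S :: "nat \<Rightarrow> nat \<Rightarrow> nat set \<Rightarrow> (nat \<times> nat \<Rightarrow> bool) \<Rightarrow> real" where
  "S i j L g = (\<Sum>l\<in>L. Z i l g * Z j l g)"

lemma nbr_commute: "nbr i j g = nbr j i g"
  by (simp add: nbr_def insert_commute mult.commute)

lemma wt_commute: "wt i j g = wt j i g"
  by (simp add: wt_def wt_term_def insert_commute mult.commute add.commute)

lemma wn_edge: "wn (edge i j) g = wt i j g * nbr i j g"
  by (auto simp: wn_def edge_def min_def max_def nbr_commute wt_commute)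

text \<open>The telescoping identity behind \<open>wt_term\<close>, summed over all triangles and
  then regrouped by edges.\<close>

lemma triangles_decomp:
  "triangles n g - (\<Sum>(i, j, k) \<in> {(i, j, k). 1 \<le> i \<and> i < j \<and> j < k \<and> k \<le> n}. pr i j * pr i k * pr j k)
    = (\<Sum>(i, j) \<in> vertex_pairs n. centred (i, j) g * wt i j g)"
proof -
  let ?c = "\<lambda>i j. edge_ind i j g - pr i j"
  have "(\<Sum>(i, j) \<in> vertex_pairs n. centred (i, j) g * wt i j g) =
      (\<Sum>(i, j) \<in> vertex_pairs n. \<Sum>k \<in> {1..n} - {i, j}. ?c i j * wt_term i j k g)"
    by (intro sum.cong refl)
       (auto simp: wt_def sum_distrib_left vertex_pairs_def edge_ind_def pe_def)
  also have "\<dots> = (\<Sum>(i, j, k) \<in> {(i, j, k). 1 \<le> i \<and> i < j \<and> j < k \<and> k \<le> n}.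
      ?c i j * wt_term i j k g + ?c i k * wt_term i k j g + ?c j k * wt_term j k i g)"
    by (rule sum_vertex_pairs_third)
  also have "\<dots> = (\<Sum>(i, j, k) \<in> {(i, j, k). 1 \<le> i \<and> i < j \<and> j < k \<and> k \<le> n}.
      edge_ind i j g * edge_ind j k g * edge_ind k i g - pr i j * pr i k * pr j k)"
    by (intro sum.cong refl, clarsimp)
       (simp add: wt_term_def edge_ind_commute[of _ _ g] edge_prob_commute[of m] field_simps)
  finally show ?thesis
    by (simp add: triangles_def sum_subtractf case_prod_unfold)
qed

text \<open>Only triangles through the edge change, and each triple contains the edge in at most one
  of its three positions.\<close>

lemma flip_diff_triangles:
  assumes "(a, b) \<in> vertex_pairs n"
  shows "flip_diff (a, b) (triangles n) g = nbr a b g"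
proof -
  let ?T = "{(i, j, k). 1 \<le> i \<and> i < j \<and> j < k \<and> k \<le> n}"
  let ?F = "\<lambda>i j k. of_bool ((a, b) = (i, j)) * (edge_ind i k g * edge_ind j k g)"
  have "flip_diff (a, b) (triangles n) g = (\<Sum>(i, j, k) \<in> ?T. ?F i j k + ?F i k j + ?F j k i)"
    unfolding flip_diff_def triangles_def sum_subtractf[symmetric]
    by (intro sum.cong refl, clarsimp simp: edge_ind_upd edge_def)
       (auto simp: edge_ind_commute)
  also have "\<dots> = (\<Sum>(i, j) \<in> vertex_pairs n. \<Sum>k \<in> {1..n} - {i, j}. ?F i j k)"
    by (rule sum_vertex_pairs_third[symmetric])
  also have "\<dots> = (\<Sum>e \<in> vertex_pairs n. if e = (a, b) then nbr a b g else 0)"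
  proof (intro sum.cong refl)
    fix e :: "nat \<times> nat"
    obtain i j where "e = (i, j)" by force
    then show "(case e of (i, j) \<Rightarrow> \<Sum>k \<in> {1..n} - {i, j}. ?F i j k) = (if e = (a, b) then nbr a b g else 0)"
      by (cases "(a, b) = (i, j)") (auto simp: nbr_def)
  qed
  also have "\<dots> = nbr a b g"
    using assms by (simp add: finite_vertex_pairs)
  finally show ?thesis .
qed

section \<open>Pointwise bounds for the weights and their differences\<close>

lemma nbr_nonneg: "0 \<le> nbr i j g"
  unfolding nbr_def by (intro sum_nonneg mult_nonneg_nonneg edge_ind_bounds)

lemma wt_term_bounds:
  assumes "i \<in> {1..n}" "j \<in> {1..n}" "k \<in> {1..n}"
  shows "0 \<le> wt_term i j k g" "wt_term i j k g \<le> 4 / 3 * (Z i k g * Z j k g)"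
    "(edge_ind i k g * edge_ind j k g + pr i k * pr j k) / 3 \<le> wt_term i j k g"
proof -
  have nn: "0 \<le> edge_ind i k g * edge_ind j k g" "0 \<le> pr i k * edge_ind j k g"
    "0 \<le> pr j k * edge_ind i k g" "0 \<le> pr i k * pr j k"
    using assms by (auto intro!: mult_nonneg_nonneg pr_bounds edge_ind_bounds)
  \<comment> \<open>The product of the two averages expands into all four mixed products with equal
    coefficients, each at least the coefficient in \<open>wt_term\<close>.\<close>
  have Z4: "4 / 3 * (Z i k g * Z j k g) = (edge_ind i k g * edge_ind j k g + pr i k * edge_ind j k g
      + pr j k * edge_ind i k g + pr i k * pr j k) / 3"
    by (simp add: Z_def field_simps)
  have "0 \<le> a / 3 + (b + c) / 6 + d / 3 \<and> a / 3 + (b + c) / 6 + d / 3 \<le> (a + b + c + d) / 3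
      \<and> (a + d) / 3 \<le> a / 3 + (b + c) / 6 + d / 3" if "0 \<le> a" "0 \<le> b" "0 \<le> c" "0 \<le> d" for a b c d :: real
    using that by (auto simp: field_simps)
  from this[OF nn] show "0 \<le> wt_term i j k g" "wt_term i j k g \<le> 4 / 3 * (Z i k g * Z j k g)"
    "(edge_ind i k g * edge_ind j k g + pr i k * pr j k) / 3 \<le> wt_term i j k g"
    unfolding Z4 wt_term_def by auto
qed

lemma wt_nonneg: "i \<in> {1..n} \<Longrightarrow> j \<in> {1..n} \<Longrightarrow> 0 \<le> wt i j g"
  unfolding wt_def by (intro sum_nonneg wt_term_bounds) auto

lemma Z_bounds:
  assumes "i \<in> {1..n}" "j \<in> {1..n}"
  shows "0 \<le> Z i j g" "Z i j g \<le> 1" "edge_ind i j g \<le> 2 * Z i j g" "pr i j \<le> 2 * Z i j g"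
  using pr_bounds[OF assms] edge_ind_bounds[of i j g] by (auto simp: Z_def)

lemma S_nonneg: "i \<in> {1..n} \<Longrightarrow> j \<in> {1..n} \<Longrightarrow> L \<subseteq> {1..n} \<Longrightarrow> 0 \<le> S i j L g"
  unfolding S_def by (intro sum_nonneg mult_nonneg_nonneg Z_bounds) auto

lemma sum_edge_ind_le_S:
  assumes "i \<in> {1..n}" "j \<in> {1..n}" "L \<subseteq> {1..n}"
  shows "(\<Sum>k\<in>L. edge_ind i k g * edge_ind j k g) \<le> 4 * S i j L g"
proof -
  have "edge_ind i k g * edge_ind j k g \<le> (2 * Z i k g) * (2 * Z j k g)" if "k \<in> L" for k
    using assms that by (intro mult_mono Z_bounds edge_ind_bounds mult_nonneg_nonneg) auto
  then show ?thesis
    unfolding S_def sum_distrib_left by (intro sum_mono) (simp add: mult.assoc mult.left_commute)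
qed

lemma sum_wt_term_le_S:
  assumes "i \<in> {1..n}" "j \<in> {1..n}" "L \<subseteq> {1..n}"
  shows "(\<Sum>k\<in>L. wt_term i j k g) \<le> 4 / 3 * S i j L g"
  unfolding S_def sum_distrib_left using assms by (intro sum_mono wt_term_bounds) auto

lemma Z_upd: "e \<noteq> edge i j \<Longrightarrow> Z i j (g(e := b)) = Z i j g"
  by (simp add: Z_def edge_ind_upd)

lemma S_upd: "(\<And>l. l \<in> L \<Longrightarrow> e \<noteq> edge i l \<and> e \<noteq> edge j l) \<Longrightarrow> S i j L (g(e := b)) = S i j L g"
  unfolding S_def by (intro sum.cong refl) (simp add: Z_upd)

lemma nbr_upd: "(\<And>k. k \<in> {1..n} - {i, j} \<Longrightarrow> e \<noteq> edge i k \<and> e \<noteq> edge j k) \<Longrightarrow> nbr i j (g(e := b)) = nbr i j g"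
  unfolding nbr_def by (intro sum.cong refl) (simp add: edge_ind_upd)

lemma wt_upd: "(\<And>k. k \<in> {1..n} - {i, j} \<Longrightarrow> e \<noteq> edge i k \<and> e \<noteq> edge j k) \<Longrightarrow> wt i j (g(e := b)) = wt i j g"
  unfolding wt_def wt_term_def by (intro sum.cong refl) (simp add: edge_ind_upd)

lemma indep_of_wt: "indep_of (edge i j) (wt i j)"
  unfolding indep_of_def by (intro allI wt_upd) (auto simp: edge_eq_iff)

lemma indep_of_wn: "e \<in> vertex_pairs n \<Longrightarrow> indep_of e (wn e)"
  unfolding indep_of_def wn_def
  by (auto simp: vertex_pairs_def edge_eq_pair[symmetric] edge_eq_iff intro!: arg_cong2[of _ _ _ _ "(*)"] wt_upd nbr_upd)

lemma flip_diff_wn_eq_0: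
  assumes "e \<notin> edge i ` ({1..n} - {i, j})" "e \<notin> edge j ` ({1..n} - {i, j})"
  shows "flip_diff e (wn (edge i j)) g = 0"
proof -
  have "nbr i j (g(e := b)) = nbr i j g" "wt i j (g(e := b)) = wt i j g" for b
    using assms by (auto intro!: nbr_upd wt_upd)
  then show ?thesis by (simp add: flip_diff_def wn_edge)
qed

text \<open>Flipping \<open>{i, k}\<close> touches only the summand \<open>k\<close> of
  \<open>nbr\<close> and of \<open>wt\<close>, and both changes are controlled by
  \<open>Z j k\<close>. Leaving \<open>k\<close> out of \<open>S\<close> makes the remaining factor
  independent of the edge \<open>{j, k}\<close>.\<close>

lemma flip_diff_wn:
  assumes ijk: "i \<in> {1..n}" "j \<in> {1..n}" "k \<in> {1..n}" "i \<noteq> j" "i \<noteq> k" "j \<noteq> k"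
  shows "0 \<le> flip_diff (edge i k) (wn (edge i j)) g"
    and "flip_diff (edge i k) (wn (edge i j)) g \<le> 7 * (Z j k g * (1 + S i j ({1..n} - {i, j, k}) g))"
proof -
  let ?L = "{1..n} - {i, j, k}" and ?x = "edge_ind j k g" and ?p = "pr i k" and ?q = "pr j k"
  define N0 where "N0 = (\<Sum>l\<in>?L. edge_ind i l g * edge_ind j l g)"
  define W0 where "W0 = (\<Sum>l\<in>?L. wt_term i j l g)"
  have L: "{1..n} - {i, j} = insert k ?L" using ijk by auto
  have N: "nbr i j (g(edge i k := b)) = of_bool b * ?x + N0" for b
    unfolding nbr_def L N0_def using ijk
    by (subst sum.insert) (auto simp: edge_ind_upd edge_eq_iff intro!: sum.cong)
  have W: "wt i j (g(edge i k := b)) = of_bool b * ?x / 3 + (?p * ?x + ?q * of_bool b) / 6 + ?p * ?q / 3 + W0" for b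
    unfolding wt_def L W0_def using ijk
    by (subst sum.insert) (auto simp: wt_term_def edge_ind_upd edge_eq_iff intro!: sum.cong)
  \<comment> \<open>The product rule: the change of \<open>wt\<close> times the old
    \<open>nbr\<close>, plus the change of \<open>nbr\<close> times the new
    \<open>wt\<close>.\<close>
  have flip: "flip_diff (edge i k) (wn (edge i j)) g =
      (?x / 3 + ?q / 6) * N0 + ?x * (?x / 3 + (?p * ?x + ?q) / 6 + ?p * ?q / 3 + W0)"
    unfolding flip_diff_def wn_edge N W by (simp add: field_simps)
  have N0: "0 \<le> N0" "N0 \<le> 4 * S i j ?L g"
    unfolding N0_def using ijk
    by (auto intro!: sum_nonneg mult_nonneg_nonneg edge_ind_bounds sum_edge_ind_le_S)
  have W0: "0 \<le> W0" "W0 \<le> 4 / 3 * S i j ?L g"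
    unfolding W0_def using ijk by (intro sum_nonneg wt_term_bounds sum_wt_term_le_S; auto)+
  have x: "0 \<le> ?x" "?x \<le> 1" "?x \<le> 2 * Z j k g" and p: "0 \<le> ?p" "?p \<le> 1"
    and q: "0 \<le> ?q" "?q \<le> 1" "?q \<le> 2 * Z j k g" and Z: "0 \<le> Z j k g"
    using ijk by (auto intro!: edge_ind_bounds Z_bounds pr_bounds)
  have S: "0 \<le> S i j ?L g" using ijk by (intro S_nonneg) auto
  have px: "0 \<le> ?p * ?x" "?p * ?x \<le> 1" and pq: "0 \<le> ?p * ?q" "?p * ?q \<le> 1"
    using x p q by (auto intro: mult_le_one)
  show "0 \<le> flip_diff (edge i k) (wn (edge i j)) g"
    unfolding flip using N0 W0 x q px pq by (intro add_nonneg_nonneg mult_nonneg_nonneg) auto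
  have "(?x / 3 + ?q / 6) * N0 \<le> Z j k g * (4 * S i j ?L g)"
    using N0 x q Z by (intro mult_mono) auto
  moreover have "?x / 3 + (?p * ?x + ?q) / 6 + ?p * ?q / 3 + W0 \<le> 1 + 4 / 3 * S i j ?L g"
  proof -
    have "x / 3 + (a + q) / 6 + b / 3 + w \<le> 1 + s"
      if "x \<le> 1" "a \<le> 1" "q \<le> 1" "b \<le> 1" "w \<le> s" for x a q b w s :: real
      using that by (simp add: field_simps)
    then show ?thesis using W0(2) x(2) px(2) q(2) pq(2) by blast
  qed
  then have "?x * (?x / 3 + (?p * ?x + ?q) / 6 + ?p * ?q / 3 + W0)
      \<le> (2 * Z j k g) * (1 + 4 / 3 * S i j ?L g)"
    using W0 x q px pq Z by (intro mult_mono) auto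
  moreover have "0 \<le> Z j k g * S i j ?L g" using Z S by simp
  ultimately have "flip_diff (edge i k) (wn (edge i j)) g
      \<le> Z j k g * (4 * S i j ?L g) + (2 * Z j k g) * (1 + 4 / 3 * S i j ?L g)"
    unfolding flip by linarith
  also have "\<dots> = 20 / 3 * (Z j k g * S i j ?L g) + 2 * Z j k g"
    by (simp add: algebra_simps)
  also have "\<dots> \<le> 7 * (Z j k g * S i j ?L g) + 7 * Z j k g"
    using Z \<open>0 \<le> Z j k g * S i j ?L g\<close> by linarith
  finally show "flip_diff (edge i k) (wn (edge i j)) g \<le> 7 * (Z j k g * (1 + S i j ?L g))"
    by (simp add: algebra_simps)
qed

end

section \<open>Moment bounds\<close>

lemma sum_weighted_square_le:
  fixes w a :: "'i \<Rightarrow> real"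
  assumes "\<And>j. j \<in> J \<Longrightarrow> 0 \<le> w j"
  shows "(\<Sum>j\<in>J. w j * a j)\<^sup>2 \<le> (\<Sum>j\<in>J. w j) * (\<Sum>j\<in>J. w j * (a j)\<^sup>2)"
proof -
  have "(\<Sum>j\<in>J. sqrt (w j) * (sqrt (w j) * a j))\<^sup>2
      \<le> (\<Sum>j\<in>J. (sqrt (w j))\<^sup>2) * (\<Sum>j\<in>J. (sqrt (w j) * a j)\<^sup>2)"
    by (rule Cauchy_Schwarz_ineq_sum)
  also have "(\<Sum>j\<in>J. sqrt (w j) * (sqrt (w j) * a j)) = (\<Sum>j\<in>J. w j * a j)"
    using assms by (intro sum.cong) (auto simp: mult.assoc[symmetric])
  also have "(\<Sum>j\<in>J. (sqrt (w j))\<^sup>2) = (\<Sum>j\<in>J. w j)"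
    using assms by (intro sum.cong) auto
  also have "(\<Sum>j\<in>J. (sqrt (w j) * a j)\<^sup>2) = (\<Sum>j\<in>J. w j * (a j)\<^sup>2)"
    using assms by (intro sum.cong) (auto simp: power_mult_distrib)
  finally show ?thesis .
qed

lemma sum_sum_mult:
  fixes a b :: "'i \<Rightarrow> real"
  shows "(\<Sum>i\<in>I. \<Sum>j\<in>J. a i * b j) = sum a I * sum b J"
  by (rule sum_product[symmetric])

lemma sum_sum_sum_mult:
  fixes a b c :: "'i \<Rightarrow> real"
  shows "(\<Sum>i\<in>I. \<Sum>j\<in>J. \<Sum>k\<in>K. a i * b j * c k) = sum a I * sum b J * sum c K"
proof -
  have "(\<Sum>i\<in>I. \<Sum>j\<in>J. \<Sum>k\<in>K. a i * b j * c k) = (\<Sum>i\<in>I. \<Sum>j\<in>J. a i * b j * sum c K)"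
    by (simp add: sum_distrib_left)
  also have "\<dots> = (\<Sum>i\<in>I. \<Sum>j\<in>J. a i * b j) * sum c K"
    by (simp add: sum_distrib_right)
  finally show ?thesis by (simp add: sum_sum_mult)
qed

text \<open>The lower power dominates below 1, the higher one above. It lets only the extreme powers
  of \<open>rate\<close> survive in the moment bounds.\<close>

lemma power_interpolate:
  fixes x :: real
  assumes "0 \<le> x" "j \<le> k" "k \<le> l"
  shows "x ^ k \<le> x ^ j + x ^ l"
proof (cases "x \<le> 1")
  case True
  then have "x ^ k \<le> x ^ j" using assms by (intro power_decreasing) auto
  then show ?thesis using assms by (simp add: add_increasing2)
next
  case False
  then have "x ^ k \<le> x ^ l" using assms by (intro power_increasing) auto
  then show ?thesis using assms by (simp add: add_increasing)
qed

lemma mult_power2_le_cubes: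
  fixes x y :: real
  assumes "0 \<le> x" "0 \<le> y"
  shows "x * y\<^sup>2 \<le> x ^ 3 + y ^ 3"
proof (cases "x \<le> y")
  case True
  then have "x * y\<^sup>2 \<le> y * y\<^sup>2" using assms by (intro mult_right_mono) auto
  then show ?thesis using assms by (simp add: power2_eq_square power3_eq_cube add_increasing mult.assoc)
next
  case False
  then have "x * y\<^sup>2 \<le> x * x\<^sup>2" using assms by (intro mult_left_mono power_mono) auto
  then show ?thesis using assms by (simp add: power2_eq_square power3_eq_cube add_increasing2 mult.assoc)
qed

lemma vertex_pairsE:
  assumes "e \<in> vertex_pairs n"
  obtains i j where "e = edge i j" "e = (i, j)" "i \<in> {1..n}" "j \<in> {1..n}" "i \<noteq> j"
proof -
  obtain i j where "e = (i, j)" by (cases e)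
  with assms show ?thesis by (intro that[of i j]) (auto simp: vertex_pairs_def edge_eq_pair)
qed

section \<open>Moments of common-neighbour counts and of their differences\<close>

context beta_graph
begin

definition M :: "nat \<Rightarrow> real" where
  "M s = (\<Sum>i = 1..n. m i ^ s)"

text \<open>An upper bound for the expected number of common neighbours of \<open>i\<close> and
  \<open>j\<close>, as \<open>pr i j \<le> m i * m j\<close>.\<close>

definition rate :: "nat \<Rightarrow> nat \<Rightarrow> real" where
  "rate i j = m i * m j * M 2"

definition B :: real where
  "B = M 2 ^ 3 + M 2 ^ 4 * M 5 ^ 2"

lemma M_nonneg: "0 \<le> M s"
  unfolding M_def using m_pos by (intro sum_nonneg zero_le_power) (auto intro: less_imp_le)

lemma m_nonneg: "i \<in> {1..n} \<Longrightarrow> 0 \<le> m i"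
  using m_pos by (auto intro: less_imp_le)

lemma rate_nonneg: "i \<in> {1..n} \<Longrightarrow> j \<in> {1..n} \<Longrightarrow> 0 \<le> rate i j"
  unfolding rate_def by (intro mult_nonneg_nonneg m_nonneg M_nonneg)

lemma rate_commute: "rate i j = rate j i"
  by (simp add: rate_def mult.commute)

lemma edge_ind_eq: "edge_ind i j g = of_bool (g (edge i j))"
  by (simp add: edge_ind_def edge_def)

lemma E_edge_ind:
  assumes "i \<in> {1..n}" "j \<in> {1..n}" "i \<noteq> j" "indep_of (edge i j) f"
  shows "E (\<lambda>g. edge_ind i j g * f g) = pr i j * E f"
  unfolding edge_ind_eq using assms by (subst E_coord_mult) (auto simp: pe_edge edge_in_vertex_pairs)

lemma E_Z:
  assumes "i \<in> {1..n}" "j \<in> {1..n}" "i \<noteq> j" "indep_of (edge i j) f"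
  shows "E (\<lambda>g. Z i j g * f g) = pr i j * E f"
proof -
  have "(\<lambda>g. Z i j g * f g) = (\<lambda>g. 1 / 2 * (edge_ind i j g * f g) + pr i j / 2 * f g)"
    by (rule ext) (simp add: Z_def field_simps)
  then show ?thesis
    by (simp only: E_add E_cmult E_edge_ind[OF assms])
qed

text \<open>
  Expand one factor of the power: each of its summands is at most 1 and is independent of the
  rest of the sum.
\<close>

lemma E_S_power_Suc:
  assumes ij: "i \<in> {1..n}" "j \<in> {1..n}" "i \<noteq> j" and L: "L \<subseteq> {1..n} - {i, j}"
  shows "E (\<lambda>g. S i j L g ^ Suc r) \<le> rate i j * E (\<lambda>g. (S i j L g + 1) ^ r)"
proof -
  have finL: "finite L" using L by (rule finite_subset) auto
  have LV: "L \<subseteq> {1..n}" using L by auto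
  have split: "S i j L g = Z i l g * Z j l g + S i j (L - {l}) g" if "l \<in> L" for l g
    unfolding S_def using that by (rule sum.remove[OF finL])
  have ZZ: "0 \<le> Z i l g * Z j l g" "Z i l g * Z j l g \<le> 1" if "l \<in> L" for l g
    using that ij LV Z_bounds by (auto intro!: mult_nonneg_nonneg mult_le_one simp: subset_iff)
  have Snn: "0 \<le> S i j L' g" if "L' \<subseteq> L" for L' g
    using that ij LV by (intro S_nonneg) auto
  have "E (\<lambda>g. S i j L g ^ Suc r) = (\<Sum>l\<in>L. E (\<lambda>g. Z i l g * Z j l g * S i j L g ^ r))"
    by (simp add: E_sum[symmetric] sum_distrib_right[symmetric] S_def[symmetric])
  also have "\<dots> \<le> (\<Sum>l\<in>L. E (\<lambda>g. Z i l g * (Z j l g * (S i j (L - {l}) g + 1) ^ r)))"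
  proof (intro sum_mono E_mono)
    fix l g assume l: "l \<in> L"
    have "S i j L g ^ r \<le> (S i j (L - {l}) g + 1) ^ r"
      using split[OF l, of g] ZZ[OF l, of g] Snn[of L g] by (intro power_mono) auto
    then show "Z i l g * Z j l g * S i j L g ^ r \<le> Z i l g * (Z j l g * (S i j (L - {l}) g + 1) ^ r)"
      unfolding mult.assoc[symmetric] using ZZ[OF l] by (intro mult_left_mono)
  qed
  also have "\<dots> = (\<Sum>l\<in>L. pr i l * (pr j l * E (\<lambda>g. (S i j (L - {l}) g + 1) ^ r)))"
  proof (intro sum.cong refl)
    fix l assume l: "l \<in> L"
    then have lij: "l \<in> {1..n}" "l \<noteq> i" "l \<noteq> j" using L by auto
    have "indep_of (edge i l) (\<lambda>g. (S i j (L - {l}) g + 1) ^ r)"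
      "indep_of (edge j l) (\<lambda>g. (S i j (L - {l}) g + 1) ^ r)"
      using ij lij L by (auto simp: indep_of_def edge_eq_iff subset_iff intro!: arg_cong[of _ _ "\<lambda>s. (s + 1) ^ r"] S_upd)
    moreover from this have "indep_of (edge i l) (\<lambda>g. Z j l g * (S i j (L - {l}) g + 1) ^ r)"
      using ij lij by (auto simp: indep_of_def Z_upd edge_eq_iff)
    ultimately show "E (\<lambda>g. Z i l g * (Z j l g * (S i j (L - {l}) g + 1) ^ r)) =
        pr i l * (pr j l * E (\<lambda>g. (S i j (L - {l}) g + 1) ^ r))"
      using ij lij by (simp add: E_Z)
  qed
  \<comment> \<open>The omitted summand is put back, so that the bound involves the full
    \<open>L\<close> again and can be iterated.\<close>
  also have "\<dots> \<le> (\<Sum>l\<in>L. m i * m l * (m j * m l * E (\<lambda>g. (S i j L g + 1) ^ r)))"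
  proof (intro sum_mono mult_mono E_mono)
    fix l g assume l: "l \<in> L"
    then have lV: "l \<in> {1..n}" using L by auto
    show "pr i l \<le> m i * m l" "pr j l \<le> m j * m l" using ij lV by (auto intro: pr_bounds)
    show "0 \<le> m i * m l" "0 \<le> m j * m l" using ij lV m_nonneg by auto
    show "(S i j (L - {l}) g + 1) ^ r \<le> (S i j L g + 1) ^ r"
      using split[OF l, of g] ZZ[OF l, of g] Snn[of "L - {l}" g] by (intro power_mono) auto
    have nn: "0 \<le> E (\<lambda>g. (S i j (L - {l}) g + 1) ^ r)"
      by (intro E_nonneg zero_le_power add_nonneg_nonneg Snn) auto
    show "0 \<le> E (\<lambda>g. (S i j (L - {l}) g + 1) ^ r)" by (rule nn)
    show "0 \<le> pr j l * E (\<lambda>g. (S i j (L - {l}) g + 1) ^ r)"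
      using ij lV nn pr_bounds by (intro mult_nonneg_nonneg) auto
  qed
  also have "\<dots> = m i * m j * (\<Sum>l\<in>L. m l ^ 2) * E (\<lambda>g. (S i j L g + 1) ^ r)"
    by (simp add: sum_distrib_left sum_distrib_right power2_eq_square mult_ac)
  also have "\<dots> \<le> rate i j * E (\<lambda>g. (S i j L g + 1) ^ r)"
    unfolding rate_def M_def using LV ij m_nonneg
    by (intro mult_right_mono mult_left_mono sum_mono2 E_nonneg zero_le_power add_nonneg_nonneg Snn) auto
  finally show ?thesis .
qed

context
  fixes i j L
  assumes ij: "i \<in> {1..n}" "j \<in> {1..n}" "i \<noteq> j" and L: "L \<subseteq> {1..n} - {i, j}"
begin

lemma S_nonneg': "0 \<le> S i j L g"
  using ij L by (intro S_nonneg) auto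

lemma E_S_le: "E (S i j L) \<le> rate i j"
  using E_S_power_Suc[OF ij L, of 0] by (simp add: E_const)

lemma E_S_power2_le: "E (\<lambda>g. (S i j L g)\<^sup>2) \<le> rate i j + (rate i j)\<^sup>2"
proof -
  have "E (\<lambda>g. (S i j L g)\<^sup>2) \<le> rate i j * (E (S i j L) + 1)"
    using E_S_power_Suc[OF ij L, of 1] by (simp add: E_add E_const power2_eq_square)
  also have "\<dots> \<le> rate i j * (rate i j + 1)"
    using E_S_le ij by (intro mult_left_mono rate_nonneg) auto
  finally show ?thesis by (simp add: power2_eq_square algebra_simps)
qed

lemma E_one_plus_S_power2_le:
  "E (\<lambda>g. (1 + S i j L g)\<^sup>2) \<le> 2 * (1 + rate i j + (rate i j)\<^sup>2)"
proof -
  have "E (\<lambda>g. (1 + S i j L g)\<^sup>2) \<le> E (\<lambda>g. 2 + 2 * (S i j L g)\<^sup>2)"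
  proof (rule E_mono)
    fix g
    show "(1 + S i j L g)\<^sup>2 \<le> 2 + 2 * (S i j L g)\<^sup>2"
      using sum_squares_bound[of 1 "S i j L g"] by (simp add: power2_sum)
  qed
  also have "\<dots> = 2 + 2 * E (\<lambda>g. (S i j L g)\<^sup>2)"
    by (simp add: E_add E_cmult E_const)
  finally show ?thesis using E_S_power2_le by simp
qed

text \<open>Three applications of the moment recursion; the intermediate powers of
  \<open>rate\<close> are then interpolated between the first and the fourth.\<close>

lemma E_S_power4_le: "E (\<lambda>g. S i j L g ^ 4) \<le> 24 * (rate i j + rate i j ^ 4)"
proof -
  let ?r = "rate i j"
  have r: "0 \<le> ?r" using ij by (intro rate_nonneg)
  have cube: "(s + 1) ^ 3 \<le> 4 * (s ^ 3 + 1)" if "0 \<le> s" for s :: real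
  proof -
    have "4 * (s ^ 3 + 1) - (s + 1) ^ 3 = 3 * (s + 1) * (s - 1)\<^sup>2"
      by (simp add: power3_eq_cube power2_eq_square algebra_simps)
    also have "\<dots> \<ge> 0" using that by simp
    finally show ?thesis by simp
  qed
  have "E (\<lambda>g. S i j L g ^ 4) \<le> ?r * E (\<lambda>g. (S i j L g + 1) ^ 3)"
    using E_S_power_Suc[OF ij L, of 3] by simp
  also have "\<dots> \<le> ?r * E (\<lambda>g. 4 * (S i j L g ^ 3 + 1))"
    using r by (intro mult_left_mono E_mono cube S_nonneg')
  also have "\<dots> = 4 * ?r * (E (\<lambda>g. S i j L g ^ 3) + 1)"
    by (simp add: E_add E_cmult E_const)
  also have "\<dots> \<le> 4 * ?r * (?r * E (\<lambda>g. (1 + S i j L g)\<^sup>2) + 1)"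
    using r E_S_power_Suc[OF ij L, of 2] by (intro mult_left_mono add_mono) (simp_all add: add.commute)
  also have "\<dots> \<le> 4 * ?r * (?r * (2 * (1 + ?r + ?r\<^sup>2)) + 1)"
    using r by (intro mult_left_mono add_mono E_one_plus_S_power2_le) auto
  also have "\<dots> = 8 * ?r ^ 4 + 8 * ?r ^ 3 + 8 * ?r ^ 2 + 4 * ?r"
    by (simp add: power2_eq_square power3_eq_cube power4_eq_xxxx algebra_simps)
  also have "\<dots> \<le> 24 * (?r + ?r ^ 4)"
    using power_interpolate[OF r, of 1 3 4] power_interpolate[OF r, of 1 2 4] r by simp
  finally show ?thesis .
qed

end

text \<open>Pointwise \<open>wn\<close> is at most \<open>16/3\<close> times the square of
  \<open>S\<close>, so a fourth moment suffices; \<open>696 = 29 * 24\<close> with 29 rounded up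
  from \<open>256/9\<close>.\<close>

lemma E_wn_power2_le:
  assumes ij: "i \<in> {1..n}" "j \<in> {1..n}" "i \<noteq> j"
  shows "E (\<lambda>g. (wn (edge i j) g)\<^sup>2) \<le> 696 * (rate i j + rate i j ^ 4)"
proof -
  let ?L = "{1..n} - {i, j}"
  have "E (\<lambda>g. (wn (edge i j) g)\<^sup>2) \<le> E (\<lambda>g. 29 * S i j ?L g ^ 4)"
  proof (rule E_mono)
    fix g
    have "wt i j g * nbr i j g \<le> (4 / 3 * S i j ?L g) * (4 * S i j ?L g)"
      unfolding wt_def nbr_def
      using ij by (intro mult_mono sum_edge_ind_le_S sum_wt_term_le_S mult_nonneg_nonneg S_nonneg sum_nonneg edge_ind_bounds) auto
    then have "(wn (edge i j) g)\<^sup>2 \<le> ((4 / 3 * S i j ?L g) * (4 * S i j ?L g))\<^sup>2"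
      unfolding wn_edge using ij by (intro power_mono mult_nonneg_nonneg wt_nonneg nbr_nonneg) auto
    also have "\<dots> = 256 / 9 * S i j ?L g ^ 4"
      by (simp add: power2_eq_square power4_eq_xxxx)
    also have "\<dots> \<le> 29 * S i j ?L g ^ 4"
      by (intro mult_right_mono) auto
    finally show "(wn (edge i j) g)\<^sup>2 \<le> 29 * S i j ?L g ^ 4" .
  qed
  also have "\<dots> \<le> 29 * (24 * (rate i j + rate i j ^ 4))"
    unfolding E_cmult by (intro mult_left_mono E_S_power4_le[OF ij]) auto
  finally show ?thesis by simp
qed

lemma E_flip_diff_wn_power2_le:
  assumes ijk: "i \<in> {1..n}" "j \<in> {1..n}" "k \<in> {1..n}" "i \<noteq> j" "i \<noteq> k" "j \<noteq> k"
  shows "E (\<lambda>g. (flip_diff (edge i k) (wn (edge i j)) g)\<^sup>2)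
    \<le> 98 * (m j * m k) * (1 + rate i j + (rate i j)\<^sup>2)"
proof -
  let ?S = "S i j ({1..n} - {i, j, k})"
  have "E (\<lambda>g. (flip_diff (edge i k) (wn (edge i j)) g)\<^sup>2) \<le> E (\<lambda>g. 49 * (Z j k g * (1 + ?S g)\<^sup>2))"
  proof (rule E_mono)
    fix g
    have "(flip_diff (edge i k) (wn (edge i j)) g)\<^sup>2 \<le> (7 * (Z j k g * (1 + ?S g)))\<^sup>2"
      using flip_diff_wn[OF ijk, of g] by (intro power_mono)
    also have "\<dots> = 49 * (Z j k g * (Z j k g * (1 + ?S g)\<^sup>2))"
      by (simp add: power2_eq_square)
    \<comment> \<open>One factor \<open>Z j k\<close> is bounded by 1; the other is kept, as its
      mean supplies the factor \<open>m j * m k\<close>.\<close>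
    also have "\<dots> \<le> 49 * (Z j k g * (1 * (1 + ?S g)\<^sup>2))"
      using ijk by (intro mult_left_mono mult_right_mono Z_bounds) auto
    finally show "(flip_diff (edge i k) (wn (edge i j)) g)\<^sup>2 \<le> 49 * (Z j k g * (1 + ?S g)\<^sup>2)" by simp
  qed
  also have "\<dots> = 49 * (pr j k * E (\<lambda>g. (1 + ?S g)\<^sup>2))"
  proof -
    have "indep_of (edge j k) (\<lambda>g. (1 + ?S g)\<^sup>2)"
      using ijk by (auto simp: indep_of_def edge_eq_iff intro!: arg_cong[of _ _ "\<lambda>s. (1 + s)\<^sup>2"] S_upd)
    then show ?thesis using ijk by (simp add: E_cmult E_Z)
  qed
  also have "\<dots> \<le> 49 * (m j * m k * (2 * (1 + rate i j + (rate i j)\<^sup>2)))"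
    using ijk m_nonneg
    by (intro mult_left_mono mult_mono pr_bounds E_one_plus_S_power2_le E_nonneg mult_nonneg_nonneg) auto
  also have "\<dots> = 98 * (m j * m k) * (1 + rate i j + (rate i j)\<^sup>2)"
    by (simp add: algebra_simps)
  finally show ?thesis .
qed

text \<open>This explains the shape of \<open>B\<close>: \<open>m i * m j * rate i j\<close> is
  \<open>M 2\<close> times a product of squares, while \<open>m i * m j * rate i j ^ 4\<close> is
  \<open>M 2 ^ 4\<close> times a product of fifth powers.\<close>

lemma diagonal_bound: "(\<Sum>e \<in> vertex_pairs n. pe e * E (\<lambda>g. (wn e g)\<^sup>2)) \<le> 696 * B"
proof -
  have "(\<Sum>e \<in> vertex_pairs n. pe e * E (\<lambda>g. (wn e g)\<^sup>2))
      \<le> (\<Sum>(i, j) \<in> vertex_pairs n. m i * m j * (696 * (rate i j + rate i j ^ 4)))"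
  proof (intro sum_mono)
    fix e assume e: "e \<in> vertex_pairs n"
    then obtain i j where e_eq: "e = edge i j" and ij: "e = (i, j)" "i \<in> {1..n}" "j \<in> {1..n}" "i \<noteq> j"
      by (rule vertex_pairsE)
    have "pe (edge i j) * E (\<lambda>g. (wn (edge i j) g)\<^sup>2) \<le> m i * m j * (696 * (rate i j + rate i j ^ 4))"
      unfolding pe_edge using ij m_nonneg by (intro mult_mono pr_bounds E_wn_power2_le E_nonneg) auto
    then show "pe e * E (\<lambda>g. (wn e g)\<^sup>2) \<le> (case e of (i, j) \<Rightarrow> m i * m j * (696 * (rate i j + rate i j ^ 4)))"
      using ij(1) e_eq by simp
  qed
  also have "\<dots> \<le> (\<Sum>i = 1..n. \<Sum>j = 1..n. m i * m j * (696 * (rate i j + rate i j ^ 4)))"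
    using m_nonneg rate_nonneg by (intro sum_vertex_pairs_le) simp
  also have "\<dots> = (\<Sum>i = 1..n. \<Sum>j = 1..n. 696 * M 2 * (m i ^ 2 * m j ^ 2) + 696 * M 2 ^ 4 * (m i ^ 5 * m j ^ 5))"
    by (intro sum.cong refl) (simp add: rate_def power_mult_distrib algebra_simps power2_eq_square eval_nat_numeral)
  also have "\<dots> = 696 * M 2 * (M 2 * M 2) + 696 * M 2 ^ 4 * (M 5 * M 5)"
    unfolding M_def sum_sum_mult[symmetric] by (simp only: sum.distrib sum_distrib_left)
  also have "\<dots> = 696 * B"
    by (simp add: B_def power2_eq_square power3_eq_cube)
  finally show ?thesis .
qed

lemma one_plus_rate_le:
  assumes "0 \<le> x"
  shows "1 + x + x\<^sup>2 \<le> 3 * (1 + x ^ 3 :: real)"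
proof -
  have "x \<le> 1 + x ^ 3" "x\<^sup>2 \<le> 1 + x ^ 3"
    using power_interpolate[OF assms, of 0 1 3] power_interpolate[OF assms, of 0 2 3] by auto
  moreover have "0 \<le> x ^ 3" using assms by simp
  ultimately show ?thesis unfolding distrib_left by linarith
qed

text \<open>For \<open>e = {i, j}\<close> and \<open>e' = {i, k}\<close> the probability of
  \<open>e'\<close> and the second moment together give \<open>m i * m j * m k ^ 2\<close>. Summing
  over \<open>k\<close> restores a factor \<open>rate i j\<close>, and the diagonal computation
  applies again.\<close>

lemma off_diagonal_bound:
  "(\<Sum>e \<in> vertex_pairs n. \<Sum>e' \<in> vertex_pairs n - {e}. pe e * pe e' * E (\<lambda>g. (flip_diff e' (wn e) g)\<^sup>2))
    \<le> 588 * B"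
proof -
  have "(\<Sum>e \<in> vertex_pairs n. \<Sum>e' \<in> vertex_pairs n - {e}. pe e * pe e' * E (\<lambda>g. (flip_diff e' (wn e) g)\<^sup>2))
    \<le> (\<Sum>(i, j) \<in> vertex_pairs n. m i * m j * (588 * rate i j * (1 + rate i j ^ 3)))"
  proof (intro sum_mono)
    fix e assume e: "e \<in> vertex_pairs n"
    then obtain i j where e_eq: "e = edge i j" and ij: "e = (i, j)" "i \<in> {1..n}" "j \<in> {1..n}" "i \<noteq> j"
      by (rule vertex_pairsE)
    let ?\<phi> = "\<lambda>e'. pe e' * E (\<lambda>g. (flip_diff e' (wn e) g)\<^sup>2)"
    let ?r = "rate i j"
    have r: "0 \<le> ?r" using ij by (intro rate_nonneg)
    \<comment> \<open>Stated for arbitrary end points, so that it also covers the edges at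
      \<open>j\<close> after exchanging the roles of \<open>i\<close> and \<open>j\<close>.\<close>
    have 1: "?\<phi> (edge i k) \<le> m i * m k * (98 * (m j * m k) * (1 + rate i j + (rate i j)\<^sup>2))"
      if "k \<in> {1..n} - {i, j}" "i \<in> {1..n}" "j \<in> {1..n}" "i \<noteq> j" "e = edge i j" for i j k
      unfolding pe_edge that(5) using that m_nonneg
      by (intro mult_mono pr_bounds E_flip_diff_wn_power2_le E_nonneg) auto
    have "(\<Sum>e' \<in> vertex_pairs n - {e}. ?\<phi> e') \<le> (\<Sum>k \<in> {1..n} - {i, j}. ?\<phi> (edge i k) + ?\<phi> (edge j k))"
      using ij(2,3)
    proof (rule sum_adjacent_edges_le)
      show "0 \<le> ?\<phi> e'" if "e' \<in> vertex_pairs n" for e'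
        using that by (intro mult_nonneg_nonneg E_nonneg p_nonneg) auto
      show "?\<phi> e' = 0" if "e' \<notin> edge i ` ({1..n} - {i, j})" "e' \<notin> edge j ` ({1..n} - {i, j})" for e'
        using flip_diff_wn_eq_0[OF that] by (simp add: e_eq E_const)
    qed auto
    also have "\<dots> \<le> (\<Sum>k \<in> {1..n} - {i, j}. 196 * (m i * m j) * (1 + ?r + ?r\<^sup>2) * m k ^ 2)"
    proof (rule sum_mono)
      fix k assume k: "k \<in> {1..n} - {i, j}"
      have "?\<phi> (edge i k) + ?\<phi> (edge j k) \<le> m i * m k * (98 * (m j * m k) * (1 + rate i j + (rate i j)\<^sup>2))
         + m j * m k * (98 * (m i * m k) * (1 + rate j i + (rate j i)\<^sup>2))"
        using k ij e_eq edge_commute[of i j] by (intro add_mono 1) auto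
      also have "\<dots> = 196 * (m i * m j) * (1 + ?r + ?r\<^sup>2) * m k ^ 2"
        unfolding rate_commute[of j i] by (simp add: power2_eq_square algebra_simps)
      finally show "?\<phi> (edge i k) + ?\<phi> (edge j k) \<le> 196 * (m i * m j) * (1 + ?r + ?r\<^sup>2) * m k ^ 2" .
    qed
    also have "\<dots> = 196 * (m i * m j) * (1 + ?r + ?r\<^sup>2) * (\<Sum>k \<in> {1..n} - {i, j}. m k ^ 2)"
      by (simp add: sum_distrib_left)
    also have "\<dots> \<le> 196 * (m i * m j) * (1 + ?r + ?r\<^sup>2) * M 2"
      unfolding M_def using ij m_nonneg r by (intro mult_left_mono sum_mono2) auto
    also have "\<dots> = 196 * ?r * (1 + ?r + ?r\<^sup>2)"
      by (simp add: rate_def)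
    also have "\<dots> \<le> 196 * ?r * (3 * (1 + ?r ^ 3))"
      using r by (intro mult_left_mono one_plus_rate_le) auto
    also have "\<dots> = 588 * ?r * (1 + ?r ^ 3)"
      by (simp add: algebra_simps)
    finally have inner: "(\<Sum>e' \<in> vertex_pairs n - {e}. ?\<phi> e') \<le> 588 * ?r * (1 + ?r ^ 3)" .
    have "(\<Sum>e' \<in> vertex_pairs n - {e}. pe e * pe e' * E (\<lambda>g. (flip_diff e' (wn e) g)\<^sup>2))
        = pe e * (\<Sum>e' \<in> vertex_pairs n - {e}. ?\<phi> e')"
      by (simp add: sum_distrib_left mult.assoc)
    also have "\<dots> \<le> m i * m j * (588 * ?r * (1 + ?r ^ 3))"
      unfolding e_eq pe_edge
    proof (intro mult_mono inner[unfolded e_eq])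
      show "pr i j \<le> m i * m j" "0 \<le> m i * m j" using ij m_nonneg by (auto intro: pr_bounds)
      show "0 \<le> (\<Sum>e' \<in> vertex_pairs n - {edge i j}. pe e' * E (\<lambda>g. (flip_diff e' (wn (edge i j)) g)\<^sup>2))"
        by (intro sum_nonneg mult_nonneg_nonneg E_nonneg p_nonneg) auto
    qed
    finally show "(\<Sum>e' \<in> vertex_pairs n - {e}. pe e * pe e' * E (\<lambda>g. (flip_diff e' (wn e) g)\<^sup>2))
      \<le> (case e of (i, j) \<Rightarrow> m i * m j * (588 * rate i j * (1 + rate i j ^ 3)))"
      using ij(1) by simp
  qed
  also have "\<dots> \<le> (\<Sum>i = 1..n. \<Sum>j = 1..n. m i * m j * (588 * rate i j * (1 + rate i j ^ 3)))"
    using m_nonneg rate_nonneg by (intro sum_vertex_pairs_le) simp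
  also have "\<dots> = (\<Sum>i = 1..n. \<Sum>j = 1..n. 588 * M 2 * (m i ^ 2 * m j ^ 2) + 588 * M 2 ^ 4 * (m i ^ 5 * m j ^ 5))"
    by (intro sum.cong refl) (simp add: rate_def power_mult_distrib algebra_simps power2_eq_square eval_nat_numeral)
  also have "\<dots> = 588 * M 2 * (M 2 * M 2) + 588 * M 2 ^ 4 * (M 5 * M 5)"
    unfolding M_def sum_sum_mult[symmetric] by (simp only: sum.distrib sum_distrib_left)
  also have "\<dots> = 588 * B"
    by (simp add: B_def power2_eq_square power3_eq_cube)
  finally show ?thesis .
qed

text \<open>The second moment of half of the influence of the edge \<open>{i, k}\<close>.
  Cauchy-Schwarz is applied with the random weights \<open>pr i j * Z j k g\<close>, whose total has
  conditional mean of order at most \<open>rate i k\<close>.\<close>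

lemma E_weighted_square_le:
  assumes ik: "i \<in> {1..n}" "k \<in> {1..n}" "i \<noteq> k"
  shows "E (\<lambda>g. (\<Sum>j \<in> {1..n} - {i, k}. pr i j * (Z j k g * (1 + S i j ({1..n} - {i, j, k}) g)))\<^sup>2)
    \<le> 2 * (m i * m k) * (1 + rate i k) * (\<Sum>j = 1..n. m j ^ 2 * (1 + rate i j + (rate i j)\<^sup>2))"
proof -
  let ?J = "{1..n} - {i, k}"
  define a where "a j g = (1 + S i j ({1..n} - {i, j, k}) g)" for j g
  define w where "w j g = pr i j * Z j k g" for j g
  define A where "A j = E (\<lambda>g. (a j g)\<^sup>2)" for j
  define q where "q j = m i * m k * m j ^ 2" for j
  have w_bounds: "0 \<le> w j g" "w j g \<le> 1" if "j \<in> ?J" for j g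
    using that ik unfolding w_def by (auto intro!: mult_nonneg_nonneg mult_le_one pr_bounds Z_bounds)
  have A: "0 \<le> A j" "A j \<le> 2 * (1 + rate i j + (rate i j)\<^sup>2)" if "j \<in> ?J" for j
    using that ik unfolding A_def a_def by (intro E_nonneg E_one_plus_S_power2_le; auto)+
  have ppq: "0 \<le> pr i j * pr j k" "pr i j * pr j k \<le> q j" if "j \<in> ?J" for j
  proof -
    have j: "j \<in> {1..n}" using that by auto
    show "0 \<le> pr i j * pr j k" using ik j by (intro mult_nonneg_nonneg pr_bounds)
    have "pr i j * pr j k \<le> (m i * m j) * (m j * m k)"
      using ik j m_nonneg by (intro mult_mono pr_bounds mult_nonneg_nonneg) auto
    then show "pr i j * pr j k \<le> q j" by (simp add: q_def power2_eq_square mult_ac)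
  qed
  \<comment> \<open>The sum in \<open>a j\<close> omits the vertex \<open>k\<close>, so it reads no
    edge at \<open>k\<close>.\<close>
  have indep: "indep_of (edge j' k) (\<lambda>g. (a j g)\<^sup>2)" if "j \<in> ?J" "j' \<in> ?J" for j j'
    using that ik by (auto simp: indep_of_def a_def edge_eq_iff intro!: arg_cong[of _ _ "\<lambda>s. (1 + s)\<^sup>2"] S_upd)
  have E1: "E (\<lambda>g. w j g * (a j g)\<^sup>2) = pr i j * pr j k * A j" if "j \<in> ?J" for j
  proof -
    have "E (\<lambda>g. Z j k g * (a j g)\<^sup>2) = pr j k * A j"
      unfolding A_def using that ik by (intro E_Z indep) auto
    then show ?thesis by (simp add: w_def mult.assoc E_cmult)
  qed
  have E2: "E (\<lambda>g. w j' g * (w j g * (a j g)\<^sup>2)) = pr i j' * pr j' k * (pr i j * pr j k * A j)"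
    if "j \<in> ?J" "j' \<in> ?J - {j}" for j j'
  proof -
    have "indep_of (edge j' k) (\<lambda>g. w j g * (a j g)\<^sup>2)"
      using indep[of j j'] that ik by (auto simp: indep_of_def w_def Z_upd edge_eq_iff)
    then have "E (\<lambda>g. Z j' k g * (w j g * (a j g)\<^sup>2)) = pr j' k * E (\<lambda>g. w j g * (a j g)\<^sup>2)"
      using that ik by (intro E_Z) auto
    then show ?thesis by (simp add: w_def[of j'] mult.assoc E_cmult E1[OF that(1)])
  qed
  have "E (\<lambda>g. (\<Sum>j\<in>?J. w j g * a j g)\<^sup>2)
      \<le> E (\<lambda>g. \<Sum>j\<in>?J. w j g * (a j g)\<^sup>2 + (\<Sum>j'\<in>?J - {j}. w j' g * (w j g * (a j g)\<^sup>2)))"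
  proof (rule E_mono)
    fix g
    have "(\<Sum>j\<in>?J. w j g * a j g)\<^sup>2 \<le> (\<Sum>j'\<in>?J. w j' g) * (\<Sum>j\<in>?J. w j g * (a j g)\<^sup>2)"
      by (rule sum_weighted_square_le) (rule w_bounds)
    also have "\<dots> = (\<Sum>j\<in>?J. (\<Sum>j'\<in>?J. w j' g) * (w j g * (a j g)\<^sup>2))"
      by (rule sum_distrib_left)
    \<comment> \<open>The weight with index \<open>j\<close> is replaced by its bound 1; the
      remaining weights are independent of the factor with index \<open>j\<close>.\<close>
    also have "\<dots> \<le> (\<Sum>j\<in>?J. (1 + (\<Sum>j'\<in>?J - {j}. w j' g)) * (w j g * (a j g)\<^sup>2))"
    proof (intro sum_mono mult_right_mono)
      fix j assume j: "j \<in> ?J"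
      have "(\<Sum>j'\<in>?J. w j' g) = w j g + (\<Sum>j'\<in>?J - {j}. w j' g)"
        by (rule sum.remove) (use j in auto)
      then show "(\<Sum>j'\<in>?J. w j' g) \<le> 1 + (\<Sum>j'\<in>?J - {j}. w j' g)"
        using w_bounds[OF j] by simp
      show "0 \<le> w j g * (a j g)\<^sup>2" using w_bounds[OF j] by simp
    qed
    finally show "(\<Sum>j\<in>?J. w j g * a j g)\<^sup>2 \<le>
        (\<Sum>j\<in>?J. w j g * (a j g)\<^sup>2 + (\<Sum>j'\<in>?J - {j}. w j' g * (w j g * (a j g)\<^sup>2)))"
      by (simp add: distrib_right sum_distrib_right)
  qed
  also have "\<dots> = (\<Sum>j\<in>?J. pr i j * pr j k * A j + (\<Sum>j'\<in>?J - {j}. pr i j' * pr j' k * (pr i j * pr j k * A j)))"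
    unfolding E_sum E_add by (intro sum.cong refl arg_cong2[of _ _ _ _ "(+)"] E1 E2)
  also have "\<dots> = (\<Sum>j\<in>?J. (1 + (\<Sum>j'\<in>?J - {j}. pr i j' * pr j' k)) * (pr i j * pr j k * A j))"
    by (simp add: distrib_right sum_distrib_right)
  also have "\<dots> \<le> (\<Sum>j\<in>?J. (1 + rate i k) * (q j * (2 * (1 + rate i j + (rate i j)\<^sup>2))))"
  proof (rule sum_mono)
    fix j assume j: "j \<in> ?J"
    have "(\<Sum>j'\<in>?J - {j}. pr i j' * pr j' k) \<le> (\<Sum>j'\<in>?J - {j}. q j')"
      by (intro sum_mono ppq) auto
    also have "\<dots> \<le> (\<Sum>j'=1..n. q j')"
      using ik m_nonneg by (intro sum_mono2) (auto simp: q_def)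
    also have "\<dots> = rate i k"
      by (simp add: q_def rate_def M_def sum_distrib_left)
    finally have "1 + (\<Sum>j'\<in>?J - {j}. pr i j' * pr j' k) \<le> 1 + rate i k" by simp
    moreover have "pr i j * pr j k * A j \<le> q j * (2 * (1 + rate i j + (rate i j)\<^sup>2))"
      using ik j m_nonneg by (intro mult_mono ppq A) (auto simp: q_def)
    moreover have "0 \<le> 1 + rate i k" using rate_nonneg[OF ik(1,2)] by simp
    moreover have "0 \<le> pr i j * pr j k * A j" using ppq[OF j] A[OF j] by simp
    ultimately show "(1 + (\<Sum>j'\<in>?J - {j}. pr i j' * pr j' k)) * (pr i j * pr j k * A j)
        \<le> (1 + rate i k) * (q j * (2 * (1 + rate i j + (rate i j)\<^sup>2)))"
      by (rule mult_mono)
  qed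
  also have "\<dots> \<le> (\<Sum>j=1..n. (1 + rate i k) * (q j * (2 * (1 + rate i j + (rate i j)\<^sup>2))))"
    using ik m_nonneg rate_nonneg
    by (intro sum_mono2) (auto simp: q_def intro!: mult_nonneg_nonneg add_nonneg_nonneg)
  also have "\<dots> = 2 * (m i * m k) * (1 + rate i k) * (\<Sum>j = 1..n. m j ^ 2 * (1 + rate i j + (rate i j)\<^sup>2))"
    unfolding sum_distrib_left by (intro sum.cong refl) (simp add: q_def algebra_simps)
  finally show ?thesis
    by (simp add: w_def a_def mult.assoc)
qed

lemma flip_diff_wn_nonneg:
  assumes "e \<in> vertex_pairs n" "e' \<in> vertex_pairs n"
  shows "0 \<le> flip_diff e' (wn e) g"
proof -
  from assms(1) obtain i j where e: "e = edge i j" "i \<in> {1..n}" "j \<in> {1..n}" "i \<noteq> j"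
    by (rule vertex_pairsE)
  consider "e' \<notin> edge i ` ({1..n} - {i, j})" "e' \<notin> edge j ` ({1..n} - {i, j})"
    | k where "k \<in> {1..n} - {i, j}" "e' = edge i k"
    | k where "k \<in> {1..n} - {i, j}" "e' = edge j k"
    by blast
  then show ?thesis
  proof cases
    case 1
    then show ?thesis using e by (simp add: flip_diff_wn_eq_0)
  next
    case (2 k)
    then show ?thesis using e flip_diff_wn(1)[of i j k] by auto
  next
    case (3 k)
    then show ?thesis using e flip_diff_wn(1)[of j i k] by (auto simp: edge_commute[of i j])
  qed
qed

lemma flip_diff_sum_wn:
  "flip_diff e' (\<lambda>g. \<Sum>e\<in>vertex_pairs n. c e * wn e g) g = (\<Sum>e\<in>vertex_pairs n. c e * flip_diff e' (wn e) g)"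
  by (simp add: flip_diff_def sum_subtractf right_diff_distrib)

text \<open>Now the flipped edge is fixed and the sum runs over the edges whose \<open>wn\<close>
  reacts to it. These are \<open>{i, j}\<close> and \<open>{k, j}\<close> for a third vertex
  \<open>j\<close>, which gives the two symmetric sums.\<close>

lemma influence_bound:
  assumes ik: "i \<in> {1..n}" "k \<in> {1..n}" "i \<noteq> k"
  defines "R \<equiv> \<lambda>i k g. \<Sum>j \<in> {1..n} - {i, k}. pr i j * (Z j k g * (1 + S i j ({1..n} - {i, j, k}) g))"
  shows "0 \<le> flip_diff (edge i k) (\<lambda>g. \<Sum>e\<in>vertex_pairs n. pe e * (1 - pe e) * wn e g) g"
    and "flip_diff (edge i k) (\<lambda>g. \<Sum>e\<in>vertex_pairs n. pe e * (1 - pe e) * wn e g) g \<le> 7 * (R i k g + R k i g)"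
proof -
  let ?e' = "edge i k"
  let ?\<phi> = "\<lambda>e. pe e * (1 - pe e) * flip_diff ?e' (wn e) g"
  have e': "?e' \<in> vertex_pairs n" using ik by (intro edge_in_vertex_pairs)
  have nonneg: "0 \<le> ?\<phi> e" if "e \<in> vertex_pairs n" for e
    using that flip_diff_wn_nonneg[OF that e'] p_nonneg[OF that] p_le_1[OF that] by simp
  show "0 \<le> flip_diff ?e' (\<lambda>g. \<Sum>e\<in>vertex_pairs n. pe e * (1 - pe e) * wn e g) g"
    unfolding flip_diff_sum_wn by (intro sum_nonneg nonneg)
  have 1: "?\<phi> (edge i j) \<le> 7 * (pr i j * (Z j k g * (1 + S i j ({1..n} - {i, j, k}) g)))"
    if "j \<in> {1..n} - {i, k}" "i \<in> {1..n}" "k \<in> {1..n}" "i \<noteq> k" "?e' = edge i k" for i j k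
  proof -
    have ij: "edge i j \<in> vertex_pairs n" using that by (intro edge_in_vertex_pairs) auto
    have "?\<phi> (edge i j) \<le> pe (edge i j) * flip_diff ?e' (wn (edge i j)) g"
      using p_nonneg[OF ij] flip_diff_wn_nonneg[OF ij e', of g]
      by (intro mult_right_mono) (auto simp: mult_left_le)
    also have "\<dots> \<le> pr i j * (7 * (Z j k g * (1 + S i j ({1..n} - {i, j, k}) g)))"
      unfolding pe_edge that(5) using that
      by (intro mult_left_mono flip_diff_wn pr_bounds) auto
    finally show ?thesis by simp
  qed
  have "(\<Sum>e\<in>vertex_pairs n. ?\<phi> e) \<le> (\<Sum>j \<in> {1..n} - {i, k}. ?\<phi> (edge i j) + ?\<phi> (edge k j))"
    using ik(1,2) order_refl
  proof (rule sum_adjacent_edges_le)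
    fix e assume e: "e \<in> vertex_pairs n" "e \<notin> edge i ` ({1..n} - {i, k})" "e \<notin> edge k ` ({1..n} - {i, k})"
    from e(1) obtain a b where ab: "e = edge a b" "a \<in> {1..n}" "b \<in> {1..n}" "a \<noteq> b"
      by (rule vertex_pairsE)
    have "flip_diff ?e' (wn (edge a b)) g = 0"
      by (rule flip_diff_wn_eq_0) (use e(2,3) ab in \<open>auto simp: edge_eq_iff image_iff\<close>)
    then show "?\<phi> e = 0" by (simp add: ab)
  qed (rule nonneg)
  also have "\<dots> \<le> (\<Sum>j \<in> {1..n} - {i, k}. 7 * (pr i j * (Z j k g * (1 + S i j ({1..n} - {i, j, k}) g)))
      + 7 * (pr k j * (Z j i g * (1 + S k j ({1..n} - {k, j, i}) g))))"
    using ik edge_commute[of i k] by (intro sum_mono add_mono 1) auto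
  also have "\<dots> = 7 * (R i k g + R k i g)"
    by (simp add: R_def sum.distrib sum_distrib_left distrib_left insert_commute)
  finally show "flip_diff ?e' (\<lambda>g. \<Sum>e\<in>vertex_pairs n. pe e * (1 - pe e) * wn e g) g \<le> 7 * (R i k g + R k i g)"
    unfolding flip_diff_sum_wn .
qed

lemma one_plus_rates_le:
  fixes x y :: real
  assumes "0 \<le> x" "0 \<le> y"
  shows "(1 + x) * (1 + y + y\<^sup>2) \<le> 6 * (1 + x ^ 3 + y ^ 3)"
proof -
  have "x \<le> 1 + x ^ 3" "y \<le> 1 + y ^ 3" "y\<^sup>2 \<le> 1 + y ^ 3" "x\<^sup>2 \<le> 1 + x ^ 3"
    using power_interpolate[OF assms(1), of 0 1 3] power_interpolate[OF assms(2), of 0 1 3]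
      power_interpolate[OF assms(2), of 0 2 3] power_interpolate[OF assms(1), of 0 2 3] by auto
  moreover have "2 * (x * y) \<le> x\<^sup>2 + y\<^sup>2"
    using sum_squares_bound[of x y] by simp
  moreover have "x * y\<^sup>2 \<le> x ^ 3 + y ^ 3" by (rule mult_power2_le_cubes[OF assms])
  moreover have "0 \<le> x ^ 3" "0 \<le> y ^ 3" using assms by auto
  moreover have "(1 + x) * (1 + y + y\<^sup>2) = 1 + y + y\<^sup>2 + x + x * y + x * y\<^sup>2"
    by (simp add: algebra_simps)
  ultimately show ?thesis unfolding distrib_left by linarith
qed

text \<open>The right side of the Poincare inequality for the weighted sum of the \<open>wn\<close>.
  The influence bounds become triple sums over vertices, which factor into power sums.\<close>

lemma influence_sum_bound:
  "(\<Sum>e'\<in>vertex_pairs n. pe e' * (1 - pe e') *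
      E (\<lambda>g. (flip_diff e' (\<lambda>g. \<Sum>e\<in>vertex_pairs n. pe e * (1 - pe e) * wn e g) g)\<^sup>2)) \<le> 2352 * B"
proof -
  define R where "R = (\<lambda>i k g. \<Sum>j \<in> {1..n} - {i, k}. pr i j * (Z j k g * (1 + S i j ({1..n} - {i, j, k}) g)))"
  define Q where "Q i k = (m i * m k) * (1 + rate i k) * (\<Sum>j = 1..n. m j ^ 2 * (1 + rate i j + (rate i j)\<^sup>2))" for i k
  let ?D = "\<lambda>e'. flip_diff e' (\<lambda>g. \<Sum>e\<in>vertex_pairs n. pe e * (1 - pe e) * wn e g)"
  have Q_nonneg: "0 \<le> Q i k" if "i \<in> {1..n}" "k \<in> {1..n}" for i k
    unfolding Q_def using that m_nonneg rate_nonneg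
    by (intro mult_nonneg_nonneg sum_nonneg add_nonneg_nonneg) auto
  have ED: "E (\<lambda>g. (?D (edge i k) g)\<^sup>2) \<le> 196 * (Q i k + Q k i)"
    if ik: "i \<in> {1..n}" "k \<in> {1..n}" "i \<noteq> k" for i k
  proof -
    have "E (\<lambda>g. (?D (edge i k) g)\<^sup>2) \<le> E (\<lambda>g. 98 * ((R i k g)\<^sup>2 + (R k i g)\<^sup>2))"
    proof (rule E_mono)
      fix g
      have "(?D (edge i k) g)\<^sup>2 \<le> (7 * (R i k g + R k i g))\<^sup>2"
        unfolding R_def by (intro power_mono influence_bound[OF ik])
      also have "\<dots> \<le> 98 * ((R i k g)\<^sup>2 + (R k i g)\<^sup>2)"
        using sum_squares_bound[of "R i k g" "R k i g"] by (simp add: power2_sum power_mult_distrib)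
      finally show "(?D (edge i k) g)\<^sup>2 \<le> 98 * ((R i k g)\<^sup>2 + (R k i g)\<^sup>2)" .
    qed
    also have "\<dots> = 98 * (E (\<lambda>g. (R i k g)\<^sup>2) + E (\<lambda>g. (R k i g)\<^sup>2))"
      by (simp add: E_cmult E_add)
    also have "\<dots> \<le> 98 * (2 * Q i k + 2 * Q k i)"
      unfolding R_def Q_def using E_weighted_square_le[of i k] E_weighted_square_le[of k i] ik
      by (intro mult_left_mono add_mono) (auto simp: mult.assoc)
    finally show ?thesis by simp
  qed
  have "(\<Sum>e'\<in>vertex_pairs n. pe e' * (1 - pe e') * E (\<lambda>g. (?D e' g)\<^sup>2))
      \<le> (\<Sum>(i, k)\<in>vertex_pairs n. 196 * (m i * m k * Q i k) + 196 * (m k * m i * Q k i))"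
  proof (rule sum_mono)
    fix e assume e: "e \<in> vertex_pairs n"
    then obtain i k where e_eq: "e = edge i k" and ik: "e = (i, k)" "i \<in> {1..n}" "k \<in> {1..n}" "i \<noteq> k"
      by (rule vertex_pairsE)
    have "pe e * (1 - pe e) \<le> pe e" using p_nonneg[OF e] by (simp add: mult_left_le)
    also have "\<dots> \<le> m i * m k" unfolding e_eq pe_edge using ik by (intro pr_bounds)
    finally have "pe e * (1 - pe e) \<le> m i * m k" .
    then have "pe e * (1 - pe e) * E (\<lambda>g. (?D e g)\<^sup>2) \<le> m i * m k * (196 * (Q i k + Q k i))"
      by (rule mult_mono[OF _ ED[OF ik(2-4), folded e_eq]])
         (use ik m_nonneg in \<open>auto intro: E_nonneg\<close>)
    then show "pe e * (1 - pe e) * E (\<lambda>g. (?D e g)\<^sup>2)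
        \<le> (case e of (i, k) \<Rightarrow> 196 * (m i * m k * Q i k) + 196 * (m k * m i * Q k i))"
      using ik(1) by (simp add: algebra_simps)
  qed
  also have "\<dots> \<le> (\<Sum>i = 1..n. \<Sum>k = 1..n. 196 * (m i * m k * Q i k))"
    using m_nonneg Q_nonneg by (intro sum_vertex_pairs_sym_le) simp
  \<comment> \<open>A cubed \<open>rate\<close> raises two of the three squares to fifth powers and
    contributes \<open>M 2 ^ 3\<close>; hence \<open>1176 = 196 * 6\<close>, and the two fifth-power
    terms make up \<open>2352\<close>.\<close>
  also have "\<dots> \<le> (\<Sum>i = 1..n. \<Sum>k = 1..n. \<Sum>j = 1..n. 1176 * (m i ^ 2 * m k ^ 2 * m j ^ 2)
      + 1176 * M 2 ^ 3 * (m i ^ 5 * m k ^ 5 * m j ^ 2) + 1176 * M 2 ^ 3 * (m i ^ 5 * m k ^ 2 * m j ^ 5))"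
  proof (intro sum_mono)
    fix i k assume ik: "i \<in> {1..n}" "k \<in> {1..n}"
    have "196 * (m i * m k * Q i k) =
        (\<Sum>j = 1..n. 196 * (m i ^ 2 * m k ^ 2 * m j ^ 2) * ((1 + rate i k) * (1 + rate i j + (rate i j)\<^sup>2)))"
      unfolding Q_def sum_distrib_left by (intro sum.cong refl) (simp add: power2_eq_square mult_ac)
    also have "\<dots> \<le> (\<Sum>j = 1..n. 196 * (m i ^ 2 * m k ^ 2 * m j ^ 2) * (6 * (1 + rate i k ^ 3 + rate i j ^ 3)))"
      using ik m_nonneg rate_nonneg by (intro sum_mono mult_left_mono one_plus_rates_le) auto
    also have "\<dots> = (\<Sum>j = 1..n. 1176 * (m i ^ 2 * m k ^ 2 * m j ^ 2)
      + 1176 * M 2 ^ 3 * (m i ^ 5 * m k ^ 5 * m j ^ 2) + 1176 * M 2 ^ 3 * (m i ^ 5 * m k ^ 2 * m j ^ 5))"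
      by (intro sum.cong refl) (simp add: rate_def power_mult_distrib algebra_simps eval_nat_numeral)
    finally show "196 * (m i * m k * Q i k) \<le> (\<Sum>j = 1..n. 1176 * (m i ^ 2 * m k ^ 2 * m j ^ 2)
      + 1176 * M 2 ^ 3 * (m i ^ 5 * m k ^ 5 * m j ^ 2) + 1176 * M 2 ^ 3 * (m i ^ 5 * m k ^ 2 * m j ^ 5))" .
  qed
  also have "\<dots> = 1176 * (M 2 * M 2 * M 2) + 1176 * M 2 ^ 3 * (M 5 * M 5 * M 2) + 1176 * M 2 ^ 3 * (M 5 * M 2 * M 5)"
    unfolding M_def sum_sum_sum_mult[symmetric] by (simp only: sum.distrib sum_distrib_left)
  also have "\<dots> \<le> 2352 * B"
    using M_nonneg[of 2] by (simp add: B_def power2_eq_square power3_eq_cube power4_eq_xxxx mult_ac)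
  finally show ?thesis .
qed

end

section \<open>Variance and Kolmogorov distance\<close>

context beta_graph
begin

definition wte :: "nat \<times> nat \<Rightarrow> (nat \<times> nat \<Rightarrow> bool) \<Rightarrow> real" where
  "wte e = wt (fst e) (snd e)"

lemma wn_eq: "e \<in> vertex_pairs n \<Longrightarrow> wn e g = wte e g * flip_diff e (triangles n) g"
  by (cases e) (simp add: wn_def wte_def flip_diff_triangles)

lemma indep_of_wte: "e \<in> vertex_pairs n \<Longrightarrow> indep_of e (wte e)"
  by (metis indep_of_wt wte_def vertex_pairsE fst_conv snd_conv)

text \<open>Every summand on the right has mean 0, so the constant in the telescoped identity must
  be the expectation.\<close>

lemma triangles_minus_expectation:
  "triangles n g - E (triangles n) = (\<Sum>e\<in>vertex_pairs n. centred e g * wte e g)"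
proof -
  define c where "c = (\<Sum>(i, j, k) \<in> {(i, j, k). 1 \<le> i \<and> i < j \<and> j < k \<and> k \<le> n}. pr i j * pr i k * pr j k)"
  have T: "triangles n = (\<lambda>g. c + (\<Sum>e\<in>vertex_pairs n. centred e g * wte e g))"
    using triangles_decomp by (intro ext) (simp add: c_def wte_def case_prod_unfold algebra_simps)
  have "E (triangles n) = c"
    unfolding T E_add E_sum E_const using indep_of_wte by (simp add: E_centred_eq_0)
  then show ?thesis by (simp add: T)
qed

definition var_triangles :: real where
  "var_triangles = E (\<lambda>g. (triangles n g - E (triangles n))\<^sup>2)"

text \<open>Integration by parts with the centred triangle count itself as the test
  function.\<close>

lemma var_triangles_eq:
  "var_triangles = (\<Sum>e\<in>vertex_pairs n. pe e * (1 - pe e) * E (wn e))"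
proof -
  have "var_triangles = (\<Sum>e\<in>vertex_pairs n.
      E (\<lambda>g. centred e g * wte e g * (triangles n g - E (triangles n))))"
    unfolding var_triangles_def power2_eq_square
    by (subst triangles_minus_expectation) (simp add: sum_distrib_right E_sum)
  also have "\<dots> = (\<Sum>e\<in>vertex_pairs n. pe e * (1 - pe e) *
      E (\<lambda>g. wte e g * flip_diff e (\<lambda>g. triangles n g - E (triangles n)) g))"
    by (intro sum.cong refl E_centred indep_of_wte)
  also have "\<dots> = (\<Sum>e\<in>vertex_pairs n. pe e * (1 - pe e) * E (wn e))"
  proof (intro sum.cong refl arg_cong2[of _ _ _ _ "(*)"] arg_cong[of _ _ E] ext)
    fix e g assume "e \<in> vertex_pairs n"
    then show "wte e g * flip_diff e (\<lambda>g. triangles n g - E (triangles n)) g = wn e g"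
      by (simp add: wn_eq flip_diff_def)
  qed
  finally show ?thesis .
qed

lemma B_nonneg: "0 \<le> B"
  unfolding B_def by (intro add_nonneg_nonneg mult_nonneg_nonneg zero_le_power M_nonneg)

text \<open>The weighted sum has mean \<open>var_triangles\<close>, so the left side is its variance
  and the Poincare inequality applies.\<close>

lemma E_variance_approx_le:
  "E (\<lambda>g. (var_triangles - (\<Sum>e\<in>vertex_pairs n. pe e * (1 - pe e) * wn e g))\<^sup>2) \<le> 2352 * B"
proof -
  let ?U = "\<lambda>g. \<Sum>e\<in>vertex_pairs n. pe e * (1 - pe e) * wn e g"
  have EU: "E ?U = var_triangles"
    by (simp add: var_triangles_eq E_sum E_cmult)
  have "(\<lambda>g. (var_triangles - ?U g)\<^sup>2) = (\<lambda>g. var_triangles\<^sup>2 - 2 * var_triangles * ?U g + (?U g)\<^sup>2)"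
    by (intro ext) (simp add: power2_diff algebra_simps)
  then have "E (\<lambda>g. (var_triangles - ?U g)\<^sup>2) = E (\<lambda>g. (?U g)\<^sup>2) - (E ?U)\<^sup>2"
    unfolding EU by (simp only: E_add E_diff E_cmult E_const EU) (simp add: power2_eq_square)
  also have "\<dots> \<le> (\<Sum>e\<in>vertex_pairs n. pe e * (1 - pe e) * E (\<lambda>g. (flip_diff e ?U g)\<^sup>2))"
    using fin p_nonneg p_le_1 by (intro bernoulli_poincare) auto
  also have "\<dots> \<le> 2352 * B" by (rule influence_sum_bound)
  finally show ?thesis .
qed

lemma E_divergence_le:
  "E (\<lambda>g. (\<Sum>e\<in>vertex_pairs n. centred e g * wn e g)\<^sup>2) \<le> 1284 * B"
  using E_divergence_square[of wn] indep_of_wn diagonal_bound off_diagonal_bound by force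

lemma kolmogorov_bound:
  assumes "0 < var_triangles"
  shows "\<bar>measure_pmf.prob (beta_model n m) {g. std_triangles n m g \<le> z} - normal_cdf z\<bar>
    \<le> 121 * sqrt B / var_triangles"
proof -
  let ?v = "var_triangles" and ?V = "vertex_pairs n"
  let ?s = "sqrt ?v"
  have s: "0 < ?s" "?s * ?s = ?v" using assms by auto
  have std: "std_triangles n m g = (triangles n g - E (triangles n)) / ?s" for g
    by (simp add: std_triangles_def expectation_beta_model var_triangles_def)
  have D: "flip_diff e (std_triangles n m) g = flip_diff e (triangles n) g / ?s" for e g
    by (simp add: flip_diff_def std diff_divide_distrib)
  have wn: "wte e g / ?s * (flip_diff e (triangles n) g / ?s) = wn e g / ?v" if "e \<in> ?V" for e g
    using that s(2) by (simp add: wn_eq)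
  have "\<bar>measure_pmf.prob (beta_model n m) {g. std_triangles n m g \<le> z} - normal_cdf z\<bar>
    \<le> E (\<lambda>g. \<bar>1 - (\<Sum>e\<in>?V. pe e * (1 - pe e) * (wte e g / ?s * flip_diff e (std_triangles n m) g))\<bar>)
      + 2 * E (\<lambda>g. \<bar>\<Sum>e\<in>?V. centred e g * (wte e g / ?s * flip_diff e (std_triangles n m) g)\<bar>)"
    unfolding beta_model_eq
  proof (rule stein_kolmogorov_bound)
    show "std_triangles n m g = (\<Sum>e\<in>?V. centred e g * (wte e g / ?s))" for g
      by (simp add: std triangles_minus_expectation sum_divide_distrib)
    show "indep_of e (\<lambda>g. wte e g / ?s)" if "e \<in> ?V" for e
      using indep_of_wte[OF that] by (simp add: indep_of_def)
    show "0 \<le> wte e g / ?s" if "e \<in> ?V" for e g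
      using that s(1) by (auto simp: wte_def vertex_pairs_def intro!: divide_nonneg_nonneg wt_nonneg)
    show "0 \<le> flip_diff e (std_triangles n m) g" if "e \<in> ?V" for e g
      using that s(1) by (cases e) (simp add: D flip_diff_triangles nbr_nonneg)
  qed
  also have "(\<lambda>g. \<bar>1 - (\<Sum>e\<in>?V. pe e * (1 - pe e) * (wte e g / ?s * flip_diff e (std_triangles n m) g))\<bar>)
      = (\<lambda>g. 1 / ?v * \<bar>?v - (\<Sum>e\<in>?V. pe e * (1 - pe e) * wn e g)\<bar>)"
  proof
    fix g
    have "(\<Sum>e\<in>?V. pe e * (1 - pe e) * (wte e g / ?s * flip_diff e (std_triangles n m) g))
        = (\<Sum>e\<in>?V. pe e * (1 - pe e) * wn e g) / ?v"
      unfolding D sum_divide_distrib by (intro sum.cong refl) (subst wn, assumption, simp)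
    moreover have "1 - u / ?v = 1 / ?v * (?v - u)" for u
      using assms by (simp add: field_simps)
    ultimately show "\<bar>1 - (\<Sum>e\<in>?V. pe e * (1 - pe e) * (wte e g / ?s * flip_diff e (std_triangles n m) g))\<bar>
        = 1 / ?v * \<bar>?v - (\<Sum>e\<in>?V. pe e * (1 - pe e) * wn e g)\<bar>"
      using assms by (simp only: abs_mult) simp
  qed
  also have "(\<lambda>g. \<bar>\<Sum>e\<in>?V. centred e g * (wte e g / ?s * flip_diff e (std_triangles n m) g)\<bar>)
      = (\<lambda>g. 1 / ?v * \<bar>\<Sum>e\<in>?V. centred e g * wn e g\<bar>)"
  proof
    fix g
    have "(\<Sum>e\<in>?V. centred e g * (wte e g / ?s * flip_diff e (std_triangles n m) g))
        = (\<Sum>e\<in>?V. centred e g * wn e g) / ?v"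
      unfolding D sum_divide_distrib by (intro sum.cong refl) (subst wn, assumption, simp)
    then show "\<bar>\<Sum>e\<in>?V. centred e g * (wte e g / ?s * flip_diff e (std_triangles n m) g)\<bar>
        = 1 / ?v * \<bar>\<Sum>e\<in>?V. centred e g * wn e g\<bar>"
      using assms by simp
  qed
  also have "E (\<lambda>g. 1 / ?v * \<bar>?v - (\<Sum>e\<in>?V. pe e * (1 - pe e) * wn e g)\<bar>)
      + 2 * E (\<lambda>g. 1 / ?v * \<bar>\<Sum>e\<in>?V. centred e g * wn e g\<bar>)
      = 1 / ?v * (E (\<lambda>g. \<bar>?v - (\<Sum>e\<in>?V. pe e * (1 - pe e) * wn e g)\<bar>)
        + 2 * E (\<lambda>g. \<bar>\<Sum>e\<in>?V. centred e g * wn e g\<bar>))"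
    unfolding E_cmult by (simp add: algebra_simps)
  \<comment> \<open>First absolute moments are bounded by roots of second moments. The constants 49
    and 36 are the rounded-up roots of 2352 and 1284, and \<open>121 = 49 + 2 * 36\<close>.\<close>
  also have "\<dots> \<le> 1 / ?v * (49 * sqrt B + 2 * (36 * sqrt B))"
  proof (intro mult_left_mono add_mono)
    have sqrt_le: "sqrt (c * B) \<le> d * sqrt B" if "c \<le> d\<^sup>2" "0 \<le> d" for c d
    proof -
      have "sqrt (c * B) \<le> sqrt (d\<^sup>2 * B)"
        using that B_nonneg by (intro real_sqrt_le_mono mult_right_mono)
      then show ?thesis using that by (simp add: real_sqrt_mult)
    qed
    have "E (\<lambda>g. \<bar>?v - (\<Sum>e\<in>?V. pe e * (1 - pe e) * wn e g)\<bar>) \<le> sqrt (2352 * B)"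
      by (rule order_trans[OF E_abs_le_sqrt real_sqrt_le_mono[OF E_variance_approx_le]])
    also have "\<dots> \<le> 49 * sqrt B" by (rule sqrt_le) auto
    finally show "E (\<lambda>g. \<bar>?v - (\<Sum>e\<in>?V. pe e * (1 - pe e) * wn e g)\<bar>) \<le> 49 * sqrt B" .
    have "E (\<lambda>g. \<bar>\<Sum>e\<in>?V. centred e g * wn e g\<bar>) \<le> sqrt (1284 * B)"
      by (rule order_trans[OF E_abs_le_sqrt real_sqrt_le_mono[OF E_divergence_le]])
    also have "\<dots> \<le> 36 * sqrt B" by (rule sqrt_le) auto
    finally show "E (\<lambda>g. \<bar>\<Sum>e\<in>?V. centred e g * wn e g\<bar>) \<le> 36 * sqrt B" .
  qed (use assms in auto)
  finally show ?thesis by simp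
qed

text \<open>Pointwise \<open>wt\<close> is at least a third of \<open>nbr\<close> plus its mean
  \<open>l\<close>, and a count is at most its own square; taking means gives both orders in
  \<open>l\<close>.\<close>

lemma E_wn_ge:
  assumes ij: "i \<in> {1..n}" "j \<in> {1..n}" "i \<noteq> j"
  defines "l \<equiv> \<Sum>k \<in> {1..n} - {i, j}. pr i k * pr j k"
  shows "(l + l\<^sup>2) / 3 \<le> E (wn (edge i j))"
proof -
  let ?L = "{1..n} - {i, j}"
  have EN: "E (nbr i j) = l"
  proof -
    have "E (\<lambda>g. edge_ind i k g * edge_ind j k g) = pr i k * pr j k" if "k \<in> ?L" for k
    proof -
      have "indep_of (edge i k) (edge_ind j k)"
        using that ij by (auto simp: indep_of_def edge_ind_upd edge_eq_iff)
      moreover have "E (edge_ind j k) = pr j k"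
        using E_edge_ind[of j k "\<lambda>_. 1"] that ij by (simp add: indep_of_def E_const)
      ultimately show ?thesis using that ij by (subst E_edge_ind) auto
    qed
    then show ?thesis unfolding l_def nbr_def[abs_def] E_sum by (intro sum.cong refl) simp
  qed
  have l: "0 \<le> l" unfolding l_def using ij by (intro sum_nonneg mult_nonneg_nonneg pr_bounds) auto
  have "E (\<lambda>g. 1 / 3 * (nbr i j g + l * nbr i j g)) \<le> E (wn (edge i j))"
  proof (rule E_mono)
    fix g
    let ?x = "\<lambda>k. edge_ind i k g * edge_ind j k g"
    \<comment> \<open>Indicators are idempotent, and each summand of \<open>nbr\<close> is at most
      the whole sum; this gives \<open>nbr \<le> nbr * nbr\<close>.\<close>
    have "nbr i j g = (\<Sum>k\<in>?L. ?x k * ?x k)"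
      unfolding nbr_def by (intro sum.cong refl) (auto simp: edge_ind_def)
    also have "\<dots> \<le> (\<Sum>k\<in>?L. ?x k * nbr i j g)"
      unfolding nbr_def by (intro sum_mono mult_left_mono member_le_sum mult_nonneg_nonneg edge_ind_bounds) auto
    also have "\<dots> = nbr i j g * nbr i j g"
      by (simp add: nbr_def sum_distrib_right[symmetric])
    finally have "nbr i j g + l * nbr i j g \<le> (nbr i j g + l) * nbr i j g"
      by (simp add: algebra_simps)
    moreover have "1 / 3 * (nbr i j g + l) \<le> wt i j g"
    proof -
      have "1 / 3 * (nbr i j g + l) = (\<Sum>k\<in>?L. (edge_ind i k g * edge_ind j k g + pr i k * pr j k) / 3)"
        by (simp add: nbr_def l_def sum.distrib sum_divide_distrib[symmetric])
      also have "\<dots> \<le> wt i j g"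
        unfolding wt_def using ij by (intro sum_mono wt_term_bounds) auto
      finally show ?thesis .
    qed
    then have "1 / 3 * (nbr i j g + l) * nbr i j g \<le> wn (edge i j) g"
      unfolding wn_edge by (intro mult_right_mono nbr_nonneg)
    ultimately show "1 / 3 * (nbr i j g + l * nbr i j g) \<le> wn (edge i j) g"
      by simp
  qed
  then show ?thesis
    unfolding E_cmult E_add EN by (simp add: power2_eq_square)
qed

lemma var_triangles_ge:
  assumes m_le: "\<And>i. i \<in> {1..n} \<Longrightarrow> m i \<le> 1" and M2: "4 \<le> M 2"
  shows "M 2 ^ 2 * (M 2 + M 3 ^ 2) / 3072 \<le> var_triangles"
proof -
  \<comment> \<open>The constant is \<open>768 = 4 * 3 * 64\<close>: 4 from
    \<open>p (1 - p)\<close>, 3 from \<open>E_wn_ge\<close> and 64 from the square of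
    \<open>rate / 8\<close>.\<close>
  define f where "f i j = (M 2 * (m i ^ 2 * m j ^ 2) + M 2 ^ 2 * (m i ^ 3 * m j ^ 3)) / 768" for i j
  have pr_half: "m i * m j / 2 \<le> pr i j" "1 / 2 \<le> 1 - pr i j" if "i \<in> {1..n}" "j \<in> {1..n}" for i j
  proof -
    have mm: "0 < m i * m j" "m i * m j \<le> 1" using that m_pos m_le m_nonneg by (auto intro!: mult_le_one)
    show "m i * m j / 2 \<le> pr i j"
      unfolding edge_prob_def using mm by (intro divide_left_mono) auto
    show "1 / 2 \<le> 1 - pr i j"
      unfolding edge_prob_def using mm by (simp add: field_simps)
  qed
  have term_ge: "f i j \<le> pe (edge i j) * (1 - pe (edge i j)) * E (wn (edge i j))"
    if ij: "i \<in> {1..n}" "j \<in> {1..n}" "i \<noteq> j" for i j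
  proof -
    let ?l = "\<Sum>k \<in> {1..n} - {i, j}. pr i k * pr j k"
    let ?r = "m i * m j * M 2"
    have mm: "0 < m i * m j" using that m_pos by auto
    have "m i ^ 2 \<le> 1" "m j ^ 2 \<le> 1" using ij m_nonneg m_le by (auto intro!: power_le_one)
    \<comment> \<open>Removing the vertices \<open>i\<close> and \<open>j\<close> costs at most 2,
      which is at most half of \<open>M 2\<close> because \<open>4 \<le> M 2\<close>.\<close>
    then have "M 2 / 2 \<le> M 2 - m i ^ 2 - m j ^ 2"
      using M2 by linarith
    then have "m i * m j / 4 * (M 2 / 2) \<le> m i * m j / 4 * (M 2 - m i ^ 2 - m j ^ 2)"
      by (rule mult_left_mono) (use mm in simp)
    also have "M 2 - m i ^ 2 - m j ^ 2 = (\<Sum>k \<in> {1..n} - {i, j}. m k ^ 2)"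
    proof -
      have "M 2 = (\<Sum>k \<in> {1..n} - {i, j}. m k ^ 2) + (\<Sum>k \<in> {i, j}. m k ^ 2)"
        unfolding M_def using ij by (intro sum.subset_diff) auto
      then show ?thesis using ij by simp
    qed
    also have "m i * m j / 4 * (\<Sum>k \<in> {1..n} - {i, j}. m k ^ 2) = (\<Sum>k \<in> {1..n} - {i, j}. (m i * m k / 2) * (m j * m k / 2))"
      by (simp add: sum_distrib_left power2_eq_square mult_ac)
    also have "\<dots> \<le> ?l"
      using ij m_nonneg by (intro sum_mono mult_mono pr_half pr_bounds) auto
    finally have l: "?r / 8 \<le> ?l" by simp
    have r: "0 \<le> ?r" using mm M2 by simp
    \<comment> \<open>The linear term has coefficient \<open>8 / 768\<close>, of which
      \<open>f\<close> keeps only \<open>1 / 768\<close>.\<close>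
    have "f i j = m i * m j / 4 * ((?r / 8 + (?r / 8)\<^sup>2 / 1) / 3) - m i ^ 2 * m j ^ 2 * M 2 * (7 / 768)"
      by (simp add: f_def power2_eq_square power3_eq_cube field_simps)
    also have "\<dots> \<le> m i * m j / 4 * ((?r / 8 + (?r / 8)\<^sup>2) / 3)"
      using M2 by simp
    also have "\<dots> \<le> m i * m j / 4 * ((?l + ?l\<^sup>2) / 3)"
      using l r mm by (intro mult_left_mono divide_right_mono add_mono power_mono) auto
    also have "\<dots> \<le> m i * m j / 4 * E (wn (edge i j))"
      using mm by (intro mult_left_mono E_wn_ge ij) auto
    also have "\<dots> \<le> pr i j * (1 - pr i j) * E (wn (edge i j))"
    proof (rule mult_right_mono)
      have "m i * m j / 2 * (1 / 2) \<le> pr i j * (1 - pr i j)"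
        using ij mm by (intro mult_mono pr_half pr_bounds) auto
      then show "m i * m j / 4 \<le> pr i j * (1 - pr i j)" by simp
      show "0 \<le> E (wn (edge i j))"
        unfolding wn_edge[abs_def] using ij by (intro E_nonneg mult_nonneg_nonneg wt_nonneg nbr_nonneg)
    qed
    finally show ?thesis by (simp add: pe_edge)
  qed
  \<comment> \<open>The full double sums factor into power sums but include \<open>i = j\<close>;
    since all weights are at most 1, this diagonal is of lower order.\<close>
  have diag: "(\<Sum>i = 1..n. f i i) \<le> (M 2 * M 2 + M 2 ^ 2 * M 3) / 768"
  proof -
    have "(\<Sum>i = 1..n. f i i) \<le> (\<Sum>i = 1..n. (M 2 * m i ^ 2 + M 2 ^ 2 * m i ^ 3) / 768)"
    proof (rule sum_mono)
      fix i assume i: "i \<in> {1..n}"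
      have "m i ^ 2 * m i ^ 2 \<le> m i ^ 2 * 1" "m i ^ 3 * m i ^ 3 \<le> m i ^ 3 * 1"
        using i m_nonneg m_le by (intro mult_left_mono power_le_one; auto)+
      then show "f i i \<le> (M 2 * m i ^ 2 + M 2 ^ 2 * m i ^ 3) / 768"
        unfolding f_def using M2 by (intro divide_right_mono add_mono mult_left_mono) auto
    qed
    also have "\<dots> = (M 2 * M 2 + M 2 ^ 2 * M 3) / 768"
      unfolding sum_divide_distrib[symmetric] sum.distrib sum_distrib_left[symmetric] by (simp only: M_def)
    finally show ?thesis .
  qed
  have "2 * (\<Sum>(i, j) \<in> vertex_pairs n. f i j) = (\<Sum>(i, j) \<in> vertex_pairs n. f i j + f j i)"
    unfolding sum_distrib_left by (intro sum.cong refl) (auto simp: f_def mult.commute)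
  also have "\<dots> = (\<Sum>i = 1..n. \<Sum>j \<in> {1..n} - {i}. f i j)"
    by (rule sum_vertex_pairs_sym)
  also have "\<dots> = (\<Sum>i = 1..n. (\<Sum>j = 1..n. f i j) - f i i)"
    by (intro sum.cong refl) (simp add: sum_diff1)
  also have "\<dots> = (\<Sum>i = 1..n. \<Sum>j = 1..n. f i j) - (\<Sum>i = 1..n. f i i)"
    by (rule sum_subtractf)
  also have "(\<Sum>i = 1..n. \<Sum>j = 1..n. f i j) = (M 2 * (M 2 * M 2) + M 2 ^ 2 * (M 3 * M 3)) / 768"
    unfolding f_def sum_divide_distrib[symmetric] sum.distrib sum_distrib_left[symmetric]
    by (simp only: sum_distrib_right[symmetric] M_def)
  finally have two: "(M 2 * (M 2 * M 2) + M 2 ^ 2 * (M 3 * M 3)) / 768 - (M 2 * M 2 + M 2 ^ 2 * M 3) / 768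
      \<le> 2 * (\<Sum>(i, j) \<in> vertex_pairs n. f i j)"
    using diag by linarith
  have "M 2 ^ 2 * (M 2 + M 3 ^ 2) / 3072 \<le>
    ((M 2 * (M 2 * M 2) + M 2 ^ 2 * (M 3 * M 3)) / 768 - (M 2 * M 2 + M 2 ^ 2 * M 3) / 768) / 2"
  proof -
    \<comment> \<open>With \<open>4 \<le> M 2\<close> this shows that removing the diagonal leaves
      at least half of the double sum. Passing to unordered pairs costs another factor 2, so
      \<open>3072 = 4 * 768\<close>.\<close>
    have "0 \<le> (M 3 - 1)\<^sup>2" by simp
    then have "M 2 + M 3 ^ 2 \<le> 2 * (M 2 + M 3 * M 3 - 1 - M 3)"
      using M2 by (simp add: power2_eq_square algebra_simps)
    then have "M 2 ^ 2 * (M 2 + M 3 ^ 2) \<le> M 2 ^ 2 * (2 * (M 2 + M 3 * M 3 - 1 - M 3))"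
      by (intro mult_left_mono) auto
    also have "\<dots> = 2 * ((M 2 * (M 2 * M 2) + M 2 ^ 2 * (M 3 * M 3)) - (M 2 * M 2 + M 2 ^ 2 * M 3))"
      by (simp add: power2_eq_square algebra_simps)
    finally have *: "M 2 ^ 2 * (M 2 + M 3 ^ 2) \<le> \<dots>" .
    have "a / 3072 \<le> (b / 768 - c / 768) / 2" if "a \<le> 2 * (b - c)" for a b c :: real
      using that by simp
    from this[OF *] show ?thesis .
  qed
  also have "\<dots> \<le> (\<Sum>(i, j) \<in> vertex_pairs n. f i j)"
  proof -
    have "a / 2 \<le> b" if "a \<le> 2 * b" for a b :: real
      using that by simp
    from this[OF two] show ?thesis .
  qed
  also have "\<dots> \<le> var_triangles"
    unfolding var_triangles_eq
  proof (rule sum_mono)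
    fix e assume "e \<in> vertex_pairs n"
    then obtain i j where e_eq: "e = edge i j" and e_pair: "e = (i, j)"
      and ij: "i \<in> {1..n}" "j \<in> {1..n}" "i \<noteq> j"
      by (rule vertex_pairsE)
    have "(case e of (i, j) \<Rightarrow> f i j) = f i j" by (simp add: e_pair)
    also have "\<dots> \<le> pe e * (1 - pe e) * E (wn e)"
      by (rule term_ge[OF ij, folded e_eq])
    finally show "(case e of (i, j) \<Rightarrow> f i j) \<le> pe e * (1 - pe e) * E (wn e)" .
  qed
  finally show ?thesis .
qed

end

section \<open>The rate in terms of norms\<close>

lemma powr_inverse_power:
  fixes y :: real
  assumes "0 \<le> y" "0 < k"
  shows "(y powr (1 / real k)) ^ k = y"
  using assms by (cases "y = 0") (simp_all add: powr_power)

context beta_graph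
begin

text \<open>The fourth root \<open>x\<close> of \<open>M 2\<close> turns all fractional powers into
  natural ones; in particular \<open>x ^ 5\<close> is the norm factor with exponent 5/2. The
  constant is \<open>371712 = 121 * 3072\<close>.\<close>

lemma kolmogorov_rate:
  assumes m_le: "\<And>i. i \<in> {1..n} \<Longrightarrow> m i \<le> 1" and M2: "4 \<le> M 2"
  defines "x \<equiv> M 2 powr (1 / 4)"
  shows "\<bar>measure_pmf.prob (beta_model n m) {g. std_triangles n m g \<le> z} - normal_cdf z\<bar>
    \<le> 371712 * ((M 2 + x ^ 5 * M 5) / (x ^ 5 * (M 3 ^ 2 + M 2)))"
proof -
  have x4: "x ^ 4 = M 2" using powr_inverse_power[of "M 2" 4] M2 by (simp add: x_def)
  have x8: "x ^ 8 = M 2 ^ 2" by (simp flip: x4 power_mult)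
  have x: "1 \<le> x" using M2 by (simp add: x_def ge_one_powr_ge_zero)
  define D where "D = M 2 + M 3 ^ 2"
  have D: "0 < D" using M2 by (simp add: D_def add_pos_nonneg)
  have v: "x ^ 8 * D / 3072 \<le> var_triangles"
    unfolding x8 D_def by (rule var_triangles_ge[OF m_le M2])
  have pos: "0 < x ^ 8 * D / 3072" using x D by simp
  have "sqrt B \<le> x ^ 6 + x ^ 8 * M 5"
  proof (rule real_le_lsqrt)
    show "0 \<le> x ^ 6 + x ^ 8 * M 5" using x M_nonneg by simp
    have "B = (x ^ 6)\<^sup>2 + (x ^ 8 * M 5)\<^sup>2"
      unfolding B_def x4[symmetric] by (simp add: power_mult_distrib flip: power_mult)
    also have "\<dots> \<le> (x ^ 6 + x ^ 8 * M 5)\<^sup>2"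
      using x M_nonneg[of 5] by (simp add: power2_sum)
    finally show "B \<le> (x ^ 6 + x ^ 8 * M 5)\<^sup>2" .
  qed
  also have "\<dots> = x ^ 3 * (x ^ 3 + x ^ 5 * M 5)"
    by (simp add: algebra_simps flip: power_add)
  also have "\<dots> \<le> x ^ 3 * (M 2 + x ^ 5 * M 5)"
  proof -
    \<comment> \<open>The term is enlarged to \<open>M 2\<close> because that is the quantity
      dominated by \<open>A1\<close>.\<close>
    have "x ^ 3 \<le> x ^ 4" using x by (intro power_increasing) auto
    then show ?thesis using x by (intro mult_left_mono) (auto simp: x4)
  qed
  finally have sqrtB: "sqrt B \<le> x ^ 3 * (M 2 + x ^ 5 * M 5)" .
  have "\<bar>measure_pmf.prob (beta_model n m) {g. std_triangles n m g \<le> z} - normal_cdf z\<bar>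
      \<le> 121 * sqrt B / var_triangles"
    by (rule kolmogorov_bound) (use v pos in linarith)
  also have "\<dots> \<le> 121 * (x ^ 3 * (M 2 + x ^ 5 * M 5)) / (x ^ 8 * D / 3072)"
    using sqrtB v pos B_nonneg x M_nonneg by (intro frac_le) auto
  also have "\<dots> = 371712 * ((M 2 + x ^ 5 * M 5) * x ^ 3 / (x ^ 5 * D * x ^ 3))"
    by (simp add: field_simps flip: power_add)
  also have "\<dots> = 371712 * ((M 2 + x ^ 5 * M 5) / (x ^ 5 * D))"
    using x by (subst mult_divide_mult_cancel_right) auto
  finally show ?thesis by (simp add: D_def add.commute)
qed

lemma lp_norm_eq: "lp_norm n s m = (\<Sum>i = 1..n. m i powr s) powr (1 / s)"
  using m_nonneg by (simp add: lp_norm_def)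

lemma lp_norm_nat: "0 < s \<Longrightarrow> lp_norm n (real s) m = M s powr (1 / real s)"
  unfolding lp_norm_eq M_def using m_pos by (simp add: powr_realpow)

text \<open>Cauchy-Schwarz for the splitting of the exponent 2 into 3/4 and 5/4; the right side is
  exactly \<open>A1\<close>.\<close>

lemma M_le_lp_norms: "M 2 \<le> lp_norm n (3/2) m powr (3/4) * lp_norm n (5/2) m powr (5/4)"
proof -
  let ?P = "\<lambda>s. \<Sum>i = 1..n. m i powr s"
  have P: "0 \<le> ?P s" for s by (intro sum_nonneg) simp
  have "M 2 = (\<Sum>i = 1..n. m i powr (3/4) * m i powr (5/4))"
    unfolding M_def
  proof (intro sum.cong refl)
    fix i assume "i \<in> {1..n}"
    then have "0 \<le> m i" by (rule m_nonneg)
    then show "m i ^ 2 = m i powr (3/4) * m i powr (5/4)" by (simp flip: powr_add)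
  qed
  then have "(M 2)\<^sup>2 \<le> (\<Sum>i = 1..n. (m i powr (3/4))\<^sup>2) * (\<Sum>i = 1..n. (m i powr (5/4))\<^sup>2)"
    by (simp only: Cauchy_Schwarz_ineq_sum)
  also have "(\<Sum>i = 1..n. (m i powr (3/4))\<^sup>2) = ?P (3/2)"
    by (intro sum.cong refl) (simp add: power2_eq_square flip: powr_add)
  also have "(\<Sum>i = 1..n. (m i powr (5/4))\<^sup>2) = ?P (5/2)"
    by (intro sum.cong refl) (simp add: power2_eq_square flip: powr_add)
  finally have "M 2 \<le> sqrt (?P (3/2) * ?P (5/2))"
    by (rule real_le_rsqrt)
  also have "\<dots> = ?P (3/2) powr (1/2) * ?P (5/2) powr (1/2)"
    using P by (simp add: real_sqrt_mult powr_half_sqrt)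
  also have "\<dots> = lp_norm n (3/2) m powr (3/4) * lp_norm n (5/2) m powr (5/4)"
    unfolding lp_norm_eq by (simp add: powr_powr)
  finally show ?thesis .
qed

end

text \<open>The claimed bound without its constant, as a function of the family of norms.\<close>

definition clt_rate :: "(real \<Rightarrow> real) \<Rightarrow> real" where
  "clt_rate N =
    (N (3/2) powr (3/4) * N (5/2) powr (5/4)
      + N (3/2) powr (3/4) * N 2 powr (1/2) * N (7/2) powr (7/4) * N 4 ^ 2
      + N 2 powr (5/2) * N 5 ^ 5
      + N 2 powr (3/2) * N (5/2) powr (5/2) * N 5 powr (5/2)
      + N (7/4) powr (7/4) * N (7/2) powr (7/4))
    / (N 2 powr (5/2) * (N 3 ^ 6 + N 2 ^ 2))"

section \<open>The Kolmogorov distance and the final constant\<close>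

lemma kolmogorov_dist_normal_le:
  assumes "\<And>z. \<bar>measure_pmf.prob P {x. X x \<le> z} - normal_cdf z\<bar> \<le> c"
  shows "kolmogorov_dist (measure_pmf P) X std_normal_distribution (\<lambda>x. x) \<le> c"
  unfolding kolmogorov_dist_def using assms by (intro cSUP_least) (auto simp: normal_cdf_def)

lemma kolmogorov_dist_normal_le_1:
  "kolmogorov_dist (measure_pmf P) X std_normal_distribution (\<lambda>x. x) \<le> 1"
proof (rule kolmogorov_dist_normal_le)
  fix z
  show "\<bar>measure_pmf.prob P {x. X x \<le> z} - normal_cdf z\<bar> \<le> 1"
    using normal_cdf_nonneg[of z] normal_cdf_le_1[of z] measure_pmf.prob_le_1[of P "{x. X x \<le> z}"]
      measure_nonneg[of "measure_pmf P" "{x. X x \<le> z}"] by linarith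
qed

lemma lp_norm_pos:
  assumes "1 \<le> n" "\<And>i. i \<in> {1..n} \<Longrightarrow> 0 < m i"
  shows "0 < lp_norm n s m"
proof -
  have "0 < (\<Sum>i = 1..n. \<bar>m i\<bar> powr s)"
    using assms by (intro sum_pos) force+
  then show ?thesis by (simp add: lp_norm_def)
qed

text \<open>Strict positivity allows division by the rate when small \<open>n\<close> are absorbed
  into the constant.\<close>

lemma clt_rate_pos:
  assumes "\<And>s. 0 < N s"
  shows "0 < clt_rate N"
  unfolding clt_rate_def using assms
  by (intro divide_pos_pos add_pos_pos mult_pos_pos zero_less_power) (simp_all add: less_imp_neq[symmetric])

lemma kolmogorov_dist_triangles_le:
  assumes pos: "\<And>i. i \<in> {1..n} \<Longrightarrow> 0 < m i" and le: "\<And>i. i \<in> {1..n} \<Longrightarrow> m i \<le> 1"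
    and norm: "2 \<le> lp_norm n 2 m"
  shows "kolmogorov_dist (measure_pmf (beta_model n m)) (std_triangles n m) std_normal_distribution (\<lambda>x. x)
    \<le> 371712 * clt_rate (\<lambda>s. lp_norm n s m)"
proof -
  interpret beta_graph n m by unfold_locales (rule pos)
  let ?N = "\<lambda>s. lp_norm n s m"
  define x where "x = M 2 powr (1 / 4)"
  have N2: "?N 2 = M 2 powr (1 / 2)" and N3: "?N 3 = M 3 powr (1 / 3)" and N5: "?N 5 = M 5 powr (1 / 5)"
    using lp_norm_nat[of 2] lp_norm_nat[of 3] lp_norm_nat[of 5] by simp_all
  have N2sq: "?N 2 ^ 2 = M 2" using M_nonneg[of 2] powr_inverse_power[of "M 2" 2] by (simp add: N2)
  then have M2: "4 \<le> M 2" using power_mono[OF norm, of 2] by simp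
  have N2p: "?N 2 powr (5/2) = x ^ 5" using M2 by (simp add: N2 x_def powr_power powr_powr)
  have N3p: "?N 3 ^ 6 = M 3 ^ 2"
  proof -
    have "?N 3 ^ 6 = (?N 3 ^ 3) ^ 2" by (simp flip: power_mult)
    also have "?N 3 ^ 3 = M 3" using M_nonneg[of 3] powr_inverse_power[of "M 3" 3] by (simp add: N3)
    finally show ?thesis .
  qed
  have N5p: "?N 5 ^ 5 = M 5" using M_nonneg[of 5] powr_inverse_power[of "M 5" 5] by (simp add: N5)
  have "kolmogorov_dist (measure_pmf (beta_model n m)) (std_triangles n m) std_normal_distribution (\<lambda>x. x)
      \<le> 371712 * ((M 2 + x ^ 5 * M 5) / (x ^ 5 * (M 3 ^ 2 + M 2)))"
    unfolding x_def by (intro kolmogorov_dist_normal_le kolmogorov_rate le M2)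
  also have "\<dots> \<le> 371712 * clt_rate ?N"
    unfolding clt_rate_def N2p N3p N2sq N5p
  proof (intro mult_left_mono divide_right_mono)
    \<comment> \<open>The nonnegative terms \<open>A2\<close>, \<open>A4\<close> and
      \<open>A5\<close> are added to a bound by \<open>A1\<close> and \<open>A3\<close>.\<close>
    have "0 \<le> ?N (3/2) powr (3/4) * ?N 2 powr (1/2) * ?N (7/2) powr (7/4) * ?N 4 ^ 2"
      "0 \<le> ?N 2 powr (3/2) * ?N (5/2) powr (5/2) * ?N 5 powr (5/2)"
      "0 \<le> ?N (7/4) powr (7/4) * ?N (7/2) powr (7/4)" by simp_all
    then show "M 2 + x ^ 5 * M 5 \<le> ?N (3/2) powr (3/4) * ?N (5/2) powr (5/4)
      + ?N (3/2) powr (3/4) * ?N 2 powr (1/2) * ?N (7/2) powr (7/4) * ?N 4 ^ 2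
      + x ^ 5 * M 5 + ?N 2 powr (3/2) * ?N (5/2) powr (5/2) * ?N 5 powr (5/2)
      + ?N (7/4) powr (7/4) * ?N (7/2) powr (7/4)"
      using M_le_lp_norms by linarith
    show "0 \<le> x ^ 5 * (M 3 ^ 2 + M 2)"
      using M2 by (intro mult_nonneg_nonneg zero_le_power add_nonneg_nonneg) (simp_all add: x_def M_nonneg)
  qed simp
  finally show ?thesis .
qed

theorem theorem1:
  fixes \<mu> :: "nat \<Rightarrow> nat \<Rightarrow> real"
  assumes pos: "\<And>n i. n \<ge> 3 \<Longrightarrow> i \<in> {1..n} \<Longrightarrow> \<mu> n i > 0"
    and max_to_0: "(\<lambda>n. vec_max n (\<mu> n)) \<longlonglongrightarrow> 0"
    and norm2_to_infinity: "filterlim (\<lambda>n. lp_norm n 2 (\<mu> n)) at_top sequentially"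
  shows "\<exists>C>0. \<forall>n\<ge>3.
    (let N = (\<lambda>s. lp_norm n s (\<mu> n));
         A1 = N (3/2) powr (3/4) * N (5/2) powr (5/4);
         A2 = N (3/2) powr (3/4) * N 2 powr (1/2) * N (7/2) powr (7/4) * N 4 ^ 2;
         A3 = N 2 powr (5/2) * N 5 ^ 5;
         A4 = N 2 powr (3/2) * N (5/2) powr (5/2) * N 5 powr (5/2);
         A5 = N (7/4) powr (7/4) * N (7/2) powr (7/4)
     in kolmogorov_dist (measure_pmf (beta_model n (\<mu> n))) (std_triangles n (\<mu> n))
          std_normal_distribution (\<lambda>x. x)
        \<le> C / (N 2 powr (5/2) * (N 3 ^ 6 + N 2 ^ 2)) * (A1 + A2 + A3 + A4 + A5))"
proof -
  let ?d = "\<lambda>n. kolmogorov_dist (measure_pmf (beta_model n (\<mu> n))) (std_triangles n (\<mu> n))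
    std_normal_distribution (\<lambda>x. x)"
  define R where "R n = clt_rate (\<lambda>s. lp_norm n s (\<mu> n))" for n
  have R: "0 < R n" if "3 \<le> n" for n
    unfolding R_def using that pos by (intro clt_rate_pos lp_norm_pos) auto
  \<comment> \<open>Beyond a threshold all weights are below 1 and the squared norm is at least 4,
    as the variance bound requires.\<close>
  have "eventually (\<lambda>n. vec_max n (\<mu> n) < 1 \<and> 2 \<le> lp_norm n 2 (\<mu> n)) sequentially"
    using order_tendstoD(2)[OF max_to_0, of 1] norm2_to_infinity
    by (auto simp: filterlim_at_top intro: eventually_conj)
  then obtain n0 where n0: "vec_max n (\<mu> n) < 1" "2 \<le> lp_norm n 2 (\<mu> n)" if "n0 \<le> n" for n
    by (auto simp: eventually_sequentially)
  \<comment> \<open>The reciprocals of the finitely many early rates are added so that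
    \<open>C * R n\<close> is at least 1 there, where the distance is bounded by 1.\<close>
  define C where "C = 371712 + (\<Sum>n = 3..<n0. 1 / R n)"
  have sum_nn: "0 \<le> (\<Sum>n = 3..<n0. 1 / R n)"
    using R by (intro sum_nonneg) (auto intro: less_imp_le)
  have "?d n \<le> C * R n" if n: "3 \<le> n" for n
  proof (cases "n0 \<le> n")
    case True
    have "\<mu> n i \<le> 1" if "i \<in> {1..n}" for i
    proof -
      have "\<mu> n i \<le> vec_max n (\<mu> n)" unfolding vec_max_def using that by (intro Max_ge) auto
      then show ?thesis using n0(1)[OF True] by simp
    qed
    then have "?d n \<le> 371712 * R n"
      unfolding R_def using pos n n0(2)[OF True] by (intro kolmogorov_dist_triangles_le) auto
    also have "\<dots> \<le> C * R n"
      using R[OF n] sum_nn by (intro mult_right_mono) (auto simp: C_def)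
    finally show ?thesis .
  next
    case False
    have "1 / R n \<le> (\<Sum>n = 3..<n0. 1 / R n)"
      using n False R by (intro member_le_sum) (auto intro: less_imp_le)
    then have "1 / R n \<le> C" by (simp add: C_def)
    then have "1 \<le> C * R n" using R[OF n] by (simp add: field_simps)
    then show ?thesis using kolmogorov_dist_normal_le_1 order_trans by blast
  qed
  moreover have "0 < C" using sum_nn by (simp add: C_def)
  ultimately show ?thesis
    by (intro exI[of _ C]) (simp add: R_def clt_rate_def Let_def)
qed

end
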